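(* Let $\Omega\subseteq\mathbb{R}^n$ be open. For all $\widetilde{x}\in\widetilde{\Omega}_{\mathrm c}$ there exists $v\in\mathcal{G}_c(\Omega)$ such that for all $u\in\mathcal{G}^\infty(\Omega)$ $$u(\widetilde{x})=\int_\Omega v(y)u(y)\,dy\qquad\text{in }\widetilde{\mathbb{C}}.$$
   Context: All nets are indexed by $\varepsilon\in(0,1]$ and $O$-estimates are for $\varepsilon\to0$. $\widetilde{\mathbb{C}}$ is the ring of nets $(z_\varepsilon)_\varepsilon\in\mathbb{C}^{(0,1]}$ with $|z_\varepsilon|=O(\varepsilon^{-N})$ for some $N\in\mathbb{N}$, modulo the nets with $|z_\varepsilon|=O(\varepsilon^q)$ for all $q\in\mathbb{N}$. $\mathcal{G}(\Omega)=\mathcal{E}_M(\Omega)/\mathcal{N}(\Omega)$, where $\mathcal{E}_M(\Omega)$ is the set of nets $(u_\varepsilon)_\varepsilon\in C^\infty(\Omega)^{(0,1]}$ such that for all compact $K\subset\Omega$ and $\alpha\in\mathbb{N}^n$ there is $N\in\mathbb{N}$ with $\sup_{x\in K}|\partial^\alpha u_\varepsilon(x)|=O(\varepsilon^{-N})$, and $\mathcal{N}(\Omega)$ is the set of nets such that for all $K,\alpha$ and all $q\in\mathbb{N}$, $\sup_{x\in K}|\partial^\alpha u_\varepsilon(x)|=O(\varepsilon^{q})$. The support of $u\in\mathcal{G}(\Omega)$ is the complement in $\Omega$ of the largest open set on which $u$ restricts to $0$; $\mathcal{G}_c(\Omega)$ is the set of $u\in\mathcal{G}(\Omega)$ with compact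 support. $\mathcal{G}^\infty(\Omega)=\mathcal{E}_M^\infty(\Omega)/\mathcal{N}(\Omega)$ is the subalgebra of regular generalized functions, where $\mathcal{E}_M^\infty(\Omega)$ is the set of nets such that for all compact $K\subset\Omega$ there is $N\in\mathbb{N}$ such that for all $\alpha\in\mathbb{N}^n$, $\sup_{x\in K}|\partial^\alpha u_\varepsilon(x)|=O(\varepsilon^{-N})$. Generalized points: $\Omega_M$ is the set of nets $(x_\varepsilon)_\varepsilon\in\Omega^{(0,1]}$ with $|x_\varepsilon|=O(\varepsilon^{-N})$ for some $N$; $(x_\varepsilon)_\varepsilon\sim(y_\varepsilon)_\varepsilon$ iff $|x_\varepsilon-y_\varepsilon|=O(\varepsilon^q)$ for all $q\in\mathbb{N}$; $\widetilde{\Omega}=\Omega_M/\!\sim$; $\widetilde{\Omega}_{\mathrm c}$ is the set of $\widetilde{x}\in\widetilde{\Omega}$ having a representative $(x_\varepsilon)_\varepsilon$ with $x_\varepsilon\in K$ for $\varepsilon$ small, for some compact $K\subset\Omega$. For $u\in\mathcal{G}(\Omega)$ and $\widetilde{x}\in\widetilde{\Omega}_{\mathrm c}$ the point value $u(\widetilde{x}):=[(u_\varepsilon(x_\varepsilon))_\varepsilon]\in\widetilde{\mathbb{C}}$ is well defined. For $w=[(w_\varepsilon)_\varepsilon]\in\mathcal{G}_c(\Omega)$, $\int_\Omega w(y)\,dy:=[(\int_K w_\varepsilon(y)\,dy)_\varepsilon]\in\widetilde{\mathbb{C}}$, where $K\subset\Omega$ is any compact set containing $\mathrm{supp}\,w$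 in its interior. *)

theory Defs
  imports "HOL-Analysis.Analysis" "HOL-Algebra.QuotRing" "HOL-Library.Landau_Symbols"
begin

text \<open>
  A net indexed by \<open>\<epsilon> \<in> (0,1]\<close> is a total function on \<^typ>\<open>real\<close>, and a function on
  \<open>\<Omega>\<close> is a total function on the whole space. Values at indices outside \<open>{0<..1}\<close>
  or at points outside \<open>\<Omega>\<close> are junk: they are not constrained by the conditions below, and nets
  that differ only there are identified in the quotients (their difference is negligible).
  \<open>O\<close>-estimates for \<open>\<epsilon> \<rightarrow> 0\<close> are taken along the filter \<open>at_right 0\<close>.
\<close>


subsection \<open>Smooth functions and multi-index derivatives\<close>

definition partial_D :: "'n::finite \<Rightarrow> (real^'n \<Rightarrow> complex) \<Rightarrow> real^'n \<Rightarrow> complex" where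
  "partial_D i f x = vector_derivative (\<lambda>t. f (x + t *\<^sub>R axis i 1)) (at 0)"

text \<open>A fixed enumeration of the coordinates: \<open>multi_D\<close> takes the partial derivatives in this
  order. It is applied only to smooth functions, for which the order is immaterial.\<close>

definition coords :: "'n::finite list" where
  "coords = (SOME is. distinct is \<and> set is = UNIV)"

definition multi_D :: "('n::finite \<Rightarrow> nat) \<Rightarrow> (real^'n \<Rightarrow> complex) \<Rightarrow> real^'n \<Rightarrow> complex" where
  "multi_D \<alpha> f = foldr (\<lambda>i. partial_D i ^^ \<alpha> i) coords f"

text \<open>Used for open \<open>\<Omega>\<close> only.\<close>

primrec C_k :: "nat \<Rightarrow> (real^'n::finite) set \<Rightarrow> (real^'n \<Rightarrow> complex) \<Rightarrow> bool" where
  "C_k 0 \<Omega> f \<longleftrightarrow> continuous_on \<Omega> f"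
| "C_k (Suc k) \<Omega> f \<longleftrightarrow> f differentiable_on \<Omega> \<and> (\<forall>i. C_k k \<Omega> (partial_D i f))"

definition C_infinity :: "(real^'n::finite) set \<Rightarrow> (real^'n \<Rightarrow> complex) set" where
  "C_infinity \<Omega> = {f. \<forall>k. C_k k \<Omega> f}"

definition sup_D :: "(real^'n::finite) set \<Rightarrow> ('n \<Rightarrow> nat) \<Rightarrow> (real^'n \<Rightarrow> complex) \<Rightarrow> real" where
  "sup_D K \<alpha> f = (SUP x\<in>K. cmod (multi_D \<alpha> f x))"


subsection \<open>Generalized numbers\<close>

type_synonym cnet = "real \<Rightarrow> complex"

definition C_M :: "cnet set" where
  "C_M = {z. \<exists>N::nat. (\<lambda>\<epsilon>. cmod (z \<epsilon>)) \<in> O[at_right 0](\<lambda>\<epsilon>. 1 / \<epsilon> ^ N)}"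

definition C_N :: "cnet set" where
  "C_N = {z. \<forall>q::nat. (\<lambda>\<epsilon>. cmod (z \<epsilon>)) \<in> O[at_right 0](\<lambda>\<epsilon>. \<epsilon> ^ q)}"

definition C_M_ring :: "cnet ring" where
  "C_M_ring = \<lparr>carrier = C_M,
     mult = (\<lambda>z w \<epsilon>. z \<epsilon> * w \<epsilon>), one = (\<lambda>\<epsilon>. 1),
     zero = (\<lambda>\<epsilon>. 0), add = (\<lambda>z w \<epsilon>. z \<epsilon> + w \<epsilon>)\<rparr>"

definition C_tilde :: "cnet set ring" where
  "C_tilde = C_M_ring Quot C_N"

definition C_class :: "cnet \<Rightarrow> cnet set" where
  "C_class z = C_N +>\<^bsub>C_M_ring\<^esub> z"


subsection \<open>Generalized functions\<close>

type_synonym 'n fnet = "real \<Rightarrow> real^'n \<Rightarrow> complex"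

text \<open>The compact sets are taken nonempty because \<^const>\<open>Sup\<close> of the empty set of reals
  is unspecified; for \<open>K = {}\<close> the estimates are vacuous.\<close>

definition E_M :: "(real^'n::finite) set \<Rightarrow> 'n fnet set" where
  "E_M \<Omega> = {u. (\<forall>\<epsilon>\<in>{0<..1}. u \<epsilon> \<in> C_infinity \<Omega>) \<and>
     (\<forall>K \<alpha>. compact K \<and> K \<noteq> {} \<and> K \<subseteq> \<Omega> \<longrightarrow>
       (\<exists>N::nat. (\<lambda>\<epsilon>. sup_D K \<alpha> (u \<epsilon>)) \<in> O[at_right 0](\<lambda>\<epsilon>. 1 / \<epsilon> ^ N)))}"

definition E_M_inf :: "(real^'n::finite) set \<Rightarrow> 'n fnet set" where
  "E_M_inf \<Omega> = {u. (\<forall>\<epsilon>\<in>{0<..1}. u \<epsilon> \<in> C_infinity \<Omega>) \<and>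
     (\<forall>K. compact K \<and> K \<noteq> {} \<and> K \<subseteq> \<Omega> \<longrightarrow>
       (\<exists>N::nat. \<forall>\<alpha>. (\<lambda>\<epsilon>. sup_D K \<alpha> (u \<epsilon>)) \<in> O[at_right 0](\<lambda>\<epsilon>. 1 / \<epsilon> ^ N)))}"

definition E_N :: "(real^'n::finite) set \<Rightarrow> 'n fnet set" where
  "E_N \<Omega> = {u. (\<forall>\<epsilon>\<in>{0<..1}. u \<epsilon> \<in> C_infinity \<Omega>) \<and>
     (\<forall>K \<alpha>. compact K \<and> K \<noteq> {} \<and> K \<subseteq> \<Omega> \<longrightarrow>
       (\<forall>q::nat. (\<lambda>\<epsilon>. sup_D K \<alpha> (u \<epsilon>)) \<in> O[at_right 0](\<lambda>\<epsilon>. \<epsilon> ^ q)))}"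

definition E_M_ring :: "(real^'n::finite) set \<Rightarrow> 'n fnet ring" where
  "E_M_ring \<Omega> = \<lparr>carrier = E_M \<Omega>,
     mult = (\<lambda>u v \<epsilon> x. u \<epsilon> x * v \<epsilon> x), one = (\<lambda>\<epsilon> x. 1),
     zero = (\<lambda>\<epsilon> x. 0), add = (\<lambda>u v \<epsilon> x. u \<epsilon> x + v \<epsilon> x)\<rparr>"

definition G :: "(real^'n::finite) set \<Rightarrow> 'n fnet set ring" where
  "G \<Omega> = E_M_ring \<Omega> Quot E_N \<Omega>"

definition G_class :: "(real^'n::finite) set \<Rightarrow> 'n fnet \<Rightarrow> 'n fnet set" where
  "G_class \<Omega> u = E_N \<Omega> +>\<^bsub>E_M_ring \<Omega>\<^esub> u"

definition G_inf :: "(real^'n::finite) set \<Rightarrow> 'n fnet set set" where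
  "G_inf \<Omega> = G_class \<Omega> ` E_M_inf \<Omega>"

text \<open>Maps out of a quotient are defined, as in \<^const>\<open>rcoset_mult\<close>, by the union over all
  representatives of the resulting classes. As the maps are well defined, all members of such a
  union coincide, and the union is their common value.\<close>

definition G_restrict :: "(real^'n::finite) set \<Rightarrow> 'n fnet set \<Rightarrow> 'n fnet set" where
  "G_restrict \<Omega>' U = (\<Union>u\<in>U. G_class \<Omega>' u)"

text \<open>The largest open set on which \<open>U\<close> restricts to \<open>0\<close> is the union of all such sets.\<close>

definition G_supp :: "(real^'n::finite) set \<Rightarrow> 'n fnet set \<Rightarrow> (real^'n) set" where
  "G_supp \<Omega> U = \<Omega> - \<Union>{\<Omega>'. open \<Omega>' \<and> \<Omega>' \<subseteq> \<Omega> \<and> G_restrict \<Omega>' U = \<zero>\<^bsub>G \<Omega>'\<^esub>}"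

definition G_c :: "(real^'n::finite) set \<Rightarrow> 'n fnet set set" where
  "G_c \<Omega> = {U \<in> carrier (G \<Omega>). compact (G_supp \<Omega> U)}"

text \<open>Here the union ranges over the representatives \<open>w\<close> and also over the admissible compact
  sets \<open>K\<close>, of which the integral is independent.\<close>

definition G_integral :: "(real^'n::finite) set \<Rightarrow> 'n fnet set \<Rightarrow> cnet set" where
  "G_integral \<Omega> W =
     (\<Union>w\<in>W. \<Union>K\<in>{K. compact K \<and> K \<subseteq> \<Omega> \<and> G_supp \<Omega> W \<subseteq> interior K}.
        C_class (\<lambda>\<epsilon>. LINT y:K|lborel. w \<epsilon> y))"


subsection \<open>Generalized points\<close>

type_synonym 'n pnet = "real \<Rightarrow> real^'n"

definition Omega_M :: "(real^'n::finite) set \<Rightarrow> 'n pnet set" where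
  "Omega_M \<Omega> = {x. (\<forall>\<epsilon>\<in>{0<..1}. x \<epsilon> \<in> \<Omega>) \<and>
     (\<exists>N::nat. (\<lambda>\<epsilon>. norm (x \<epsilon>)) \<in> O[at_right 0](\<lambda>\<epsilon>. 1 / \<epsilon> ^ N))}"

definition Omega_rel :: "(real^'n::finite) set \<Rightarrow> ('n pnet \<times> 'n pnet) set" where
  "Omega_rel \<Omega> = {(x, y). x \<in> Omega_M \<Omega> \<and> y \<in> Omega_M \<Omega> \<and>
     (\<forall>q::nat. (\<lambda>\<epsilon>. norm (x \<epsilon> - y \<epsilon>)) \<in> O[at_right 0](\<lambda>\<epsilon>. \<epsilon> ^ q))}"

definition Omega_tilde :: "(real^'n::finite) set \<Rightarrow> 'n pnet set set" where
  "Omega_tilde \<Omega> = Omega_M \<Omega> // Omega_rel \<Omega>"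

definition Omega_tilde_c :: "(real^'n::finite) set \<Rightarrow> 'n pnet set set" where
  "Omega_tilde_c \<Omega> = {X \<in> Omega_tilde \<Omega>.
     \<exists>x\<in>X. \<exists>K. compact K \<and> K \<subseteq> \<Omega> \<and> (\<forall>\<^sub>F \<epsilon> in at_right 0. x \<epsilon> \<in> K)}"

definition point_value :: "'n::finite fnet set \<Rightarrow> 'n pnet set \<Rightarrow> cnet set" where
  "point_value U X = (\<Union>u\<in>U. \<Union>x\<in>X. C_class (\<lambda>\<epsilon>. u \<epsilon> (x \<epsilon>)))"

end

theory Submission
  imports Defs "HOL-Computational_Algebra.Polynomial"
begin

text \<open>
  If a mollifier at scale \<open>\<epsilon>\<close> has vanishing moments of orders \<open>1, \<dots>, q\<close>, then a Taylor expansion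
  shows that integrating it against \<open>u\<^sub>\<epsilon>\<close> reproduces the value of \<open>u\<^sub>\<epsilon>\<close> at the centre up to
  \<open>\<epsilon>\<^sup>q\<close> times a derivative of order \<open>q + 1\<close> of \<open>u\<^sub>\<epsilon>\<close>. For regular \<open>u\<close> all derivatives
  are \<open>O(\<epsilon>\<^bsup>-N\<^esup>)\<close> with the same \<open>N\<close>, so that the error becomes negligible if \<open>q = q(\<epsilon>)\<close> tends to
  infinity; if it does so slowly enough, the mollifiers form a moderate net.

  A compactly supported mollifier with vanishing moments is the tensor product of Richardson
  combinations \<open>\<Sum>\<^sub>l c\<^sub>l 2\<^sup>l \<psi>(2\<^sup>l t)\<close> of dilations of a bump \<open>\<psi>\<close>. Replacing the coordinates one at
  a time, only the pure derivatives \<open>\<partial>\<^sub>k\<^sup>m u\<^sub>\<epsilon>\<close> enter the error estimate.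
\<close>

subsection \<open>A smooth bump on the line\<close>

text \<open>The net \<open>v\<close> is fixed before \<open>u\<close> is known, hence before the
  exponent \<open>N\<close> in the bounds for \<open>u\<close>, so no fixed number of vanishing
  moments suffices. Nor can one test function of compact support and integral \<open>1\<close> have
  all moments of positive order equal to zero: its Fourier transform is entire and would be
  constant. Hence the number of moments must grow along the net. A derivative of growing order
  cannot enter the final estimate, because regularity makes only \<open>N\<close> uniform: the
  constants, and the range of \<epsilon> in which the bounds hold, depend on the order. For each
  target power of \<epsilon> the Taylor expansion is therefore stopped at a fixed order
  \<open>m\<close>, and the growth of \<open>q\<close> is used only through
  \<open>m \<le> q + 1\<close> for small \<epsilon>. The price of the growth is the size of the
  Richardson weights and of the dilation factor \<open>2 ^ q\<close>. Both are kept below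
  \<open>1 / \<epsilon>\<close>; in dimension \<open>n\<close> the weights then cost
  \<open>n + 1\<close> powers of \<epsilon> in the error, whatever \<open>m\<close> is.\<close>

primrec diff_upto :: "nat \<Rightarrow> (real \<Rightarrow> real) \<Rightarrow> bool" where
  "diff_upto 0 f \<longleftrightarrow> True"
| "diff_upto (Suc n) f \<longleftrightarrow> (\<exists>f'. (\<forall>x. (f has_real_derivative f' x) (at x)) \<and> diff_upto n f')"

definition smooth1 :: "(real \<Rightarrow> real) \<Rightarrow> bool" where
  "smooth1 f \<longleftrightarrow> (\<forall>n. diff_upto n f)"

lemma diff_upto_Suc_imp: "diff_upto (Suc n) f \<Longrightarrow> diff_upto n f"
  by (induction n arbitrary: f) auto

lemma diff_upto_add:
  "diff_upto n f \<Longrightarrow> diff_upto n g \<Longrightarrow> diff_upto n (\<lambda>x. f x + g x)"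
proof (induction n arbitrary: f g)
  case (Suc n)
  then obtain f' g' where "\<forall>x. (f has_real_derivative f' x) (at x)" "diff_upto n f'"
    "\<forall>x. (g has_real_derivative g' x) (at x)" "diff_upto n g'"
    by auto
  then show ?case using Suc.IH by (auto intro!: exI[of _ "\<lambda>x. f' x + g' x"] DERIV_add)
qed simp

lemma diff_upto_mult:
  "diff_upto n f \<Longrightarrow> diff_upto n g \<Longrightarrow> diff_upto n (\<lambda>x. f x * g x)"
proof (induction n arbitrary: f g)
  case (Suc n)
  then obtain f' g' where *: "\<forall>x. (f has_real_derivative f' x) (at x)" "diff_upto n f'"
    "\<forall>x. (g has_real_derivative g' x) (at x)" "diff_upto n g'"
    by auto
  have "diff_upto n (\<lambda>x. f' x * g x + f x * g' x)"
    using * Suc.prems[THEN diff_upto_Suc_imp] by (intro diff_upto_add Suc.IH)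
  moreover have "((\<lambda>x. f x * g x) has_real_derivative f' x * g x + f x * g' x) (at x)" for x
    using * by (auto intro!: derivative_eq_intros)
  ultimately show ?case
    unfolding diff_upto.simps by (intro exI[of _ "\<lambda>x. f' x * g x + f x * g' x"]) blast
qed simp

text \<open>The weights \<open>b\<close> vary in the induction because each differentiation
  multiplies them by the inner factors \<open>r l\<close>. \<open>kernel1\<close> has this shape;
  one-term sums give translations and reflections.\<close>

lemma diff_upto_sum_affine:
  "diff_upto n f \<Longrightarrow> diff_upto n (\<lambda>t. \<Sum>l\<in>L. b l * f ((t - x) * r l))"
proof (induction n arbitrary: f b)
  case (Suc n)
  then obtain f' where *: "\<And>x. (f has_real_derivative f' x) (at x)" "diff_upto n f'"
    by auto
  have "((\<lambda>t. \<Sum>l\<in>L. b l * f ((t - x) * r l)) has_real_derivative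
      (\<Sum>l\<in>L. (b l * r l) * f' ((t - x) * r l))) (at t)" for t
    by (auto intro!: derivative_eq_intros sum.cong DERIV_chain2[of f, OF *(1)])
  with Suc.IH[OF *(2), of "\<lambda>l. b l * r l"] show ?case
    unfolding diff_upto.simps
    by (intro exI[of _ "\<lambda>t. \<Sum>l\<in>L. (b l * r l) * f' ((t - x) * r l)"]) blast
qed simp

lemma smooth1_DERIV: "smooth1 f \<Longrightarrow> (f has_real_derivative deriv f x) (at x)"
  unfolding smooth1_def
  by (metis DERIV_imp_deriv diff_upto.simps(2))

text \<open>In \<open>diff_upto\<close> the derivative is an existential witness, so that closure
  proofs can exhibit it. Uniqueness of derivatives identifies the witness with
  \<open>deriv f\<close> at every level \<open>n\<close>.\<close>

lemma smooth1_deriv: "smooth1 f \<Longrightarrow> smooth1 (deriv f)"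
  unfolding smooth1_def
proof
  fix n assume "\<forall>n. diff_upto n f"
  then obtain f' where "\<forall>x. (f has_real_derivative f' x) (at x)" "diff_upto n f'"
    by (meson diff_upto.simps(2))
  moreover from this have "f' = deriv f" by (metis DERIV_imp_deriv ext)
  ultimately show "diff_upto n (deriv f)" by simp
qed

lemma smooth1_higher_deriv: "smooth1 f \<Longrightarrow> smooth1 ((deriv ^^ k) f)"
  by (induction k) (auto intro: smooth1_deriv)

lemma smooth1_continuous: "smooth1 f \<Longrightarrow> continuous_on S f"
  by (meson DERIV_isCont continuous_at_imp_continuous_on smooth1_DERIV)

lemma smooth1_sum_affine: "smooth1 f \<Longrightarrow> smooth1 (\<lambda>t. \<Sum>l\<in>L. b l * f ((t - x) * r l))"
  by (simp add: smooth1_def diff_upto_sum_affine)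

lemma higher_deriv_sum_affine:
  assumes "smooth1 f"
  shows "(deriv ^^ a) (\<lambda>t. \<Sum>l\<in>L. b l * f ((t - x) * r l))
       = (\<lambda>t. \<Sum>l\<in>L. b l * r l ^ a * (deriv ^^ a) f ((t - x) * r l))"
proof (induction a)
  case (Suc a)
  let ?f = "(deriv ^^ a) f"
  have *: "(?f has_real_derivative deriv ?f t) (at t)" for t
    using assms by (intro smooth1_DERIV smooth1_higher_deriv)
  have "((\<lambda>t. \<Sum>l\<in>L. b l * r l ^ a * ?f ((t - x) * r l)) has_real_derivative
      (\<Sum>l\<in>L. b l * r l ^ Suc a * deriv ?f ((t - x) * r l))) (at t)" for t
    by (auto intro!: derivative_eq_intros sum.cong DERIV_chain2[of ?f, OF *])
  then show ?case by (auto simp: Suc DERIV_imp_deriv)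
qed simp

text \<open>A family that contains \<open>exp (- 1 / t)\<close>, extended by \<open>0\<close>, and
  is closed under differentiation: admitting all polynomials in \<open>1 / t\<close> reduces
  smoothness to one derivative formula.\<close>

definition flat :: "real poly \<Rightarrow> real \<Rightarrow> real" where
  "flat p t = (if t > 0 then poly p (1 / t) * exp (- 1 / t) else 0)"

lemma tendsto_poly_exp_at_top: "((\<lambda>x. poly p x * exp (- x)) \<longlongrightarrow> (0::real)) at_top"
proof -
  have "((\<lambda>x. \<Sum>i\<le>degree p. coeff p i * (x ^ i / exp x)) \<longlongrightarrow> (\<Sum>i\<le>degree p. coeff p i * 0)) at_top"
    by (intro tendsto_intros tendsto_power_div_exp_0)
  moreover have "(\<lambda>x. poly p x * exp (- x)) = (\<lambda>x. \<Sum>i\<le>degree p. coeff p i * (x ^ i / exp x))"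
    by (simp add: poly_altdef sum_distrib_right exp_minus divide_inverse mult.assoc)
  ultimately show ?thesis by simp
qed

text \<open>For \<open>t > 0\<close> both terms of the product rule carry the factor
  \<open>(1 / t)^2\<close>, which is the polynomial \<open>[:0, 0, 1:]\<close>, and the derivative
  of \<open>1 / t\<close> makes the sign of \<open>pderiv p\<close> negative.\<close>

lemma flat_DERIV:
  "(flat p has_real_derivative flat ([:0, 0, 1:] * (p - pderiv p)) t) (at t)"
proof -
  consider "t > 0" | "t < 0" | "t = 0" by linarith
  then show ?thesis
  proof cases
    case 1
    have "((\<lambda>t. poly p (1 / t) * exp (- 1 / t)) has_real_derivative
        flat ([:0, 0, 1:] * (p - pderiv p)) t) (at t)"
      using 1 by (auto intro!: derivative_eq_intros DERIV_chain2[of "poly p"] poly_DERIV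
          simp: flat_def field_simps power2_eq_square)
    then show ?thesis
      by (rule has_field_derivative_transform_within_open[of _ _ _ "{0<..}"])
        (use 1 in \<open>auto simp: flat_def\<close>)
  next
    case 2
    have "((\<lambda>t. 0) has_real_derivative flat ([:0, 0, 1:] * (p - pderiv p)) t) (at t)"
      using 2 by (simp add: flat_def)
    then show ?thesis
      by (rule has_field_derivative_transform_within_open[of _ _ _ "{..<0}"])
        (use 2 in \<open>auto simp: flat_def\<close>)
  next
    case 3
    \<comment> \<open>The difference quotient at \<open>0\<close> from the right is again a
      polynomial in \<open>1 / h\<close>, namely \<open>p\<close> multiplied by the variable, times
      \<open>exp (- 1 / h)\<close>.\<close>
    have "((\<lambda>h. poly (pCons 0 p) (inverse h) * exp (- inverse h)) \<longlongrightarrow> 0) (at_right 0)"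
      using filterlim_compose[OF tendsto_poly_exp_at_top filterlim_inverse_at_top_right] .
    then have "((\<lambda>h. flat p h / h) \<longlongrightarrow> 0) (at_right 0)"
      by (rule Lim_transform_eventually)
        (auto simp: flat_def eventually_at_filter field_simps)
    moreover have "((\<lambda>h. flat p h / h) \<longlongrightarrow> 0) (at_left 0)"
      by (rule Lim_transform_eventually[OF tendsto_const])
        (auto simp: flat_def eventually_at_filter)
    ultimately have "((\<lambda>h. flat p h / h) \<longlongrightarrow> 0) (at 0)"
      by (simp add: filterlim_split_at)
    then show ?thesis
      using 3 by (simp add: DERIV_def) (simp add: flat_def)
  qed
qed

lemma diff_upto_flat: "diff_upto n (flat p)"
  by (induction n arbitrary: p) (auto intro: flat_DERIV)

lemma smooth_bump_exists:
  obtains \<psi> :: "real \<Rightarrow> real" where "smooth1 \<psi>" "\<And>t. \<bar>t\<bar> < 1 \<Longrightarrow> \<psi> t > 0" "\<And>t. \<bar>t\<bar> \<ge> 1 \<Longrightarrow> \<psi> t = 0"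
proof
  \<comment> \<open>Each factor vanishes on a closed half-line and is positive on the rest; both are
    positive exactly on the interval from \<open>-1\<close> to \<open>1\<close>.\<close>
  let ?f = "\<lambda>t. flat 1 (t + 1) * flat 1 (1 - t)"
  have "diff_upto n (\<lambda>t. flat 1 (t + 1))" "diff_upto n (\<lambda>t. flat 1 (1 - t))" for n
    using diff_upto_sum_affine[OF diff_upto_flat[of n 1], where L="{()}" and b="\<lambda>_. 1" and x="- 1" and r="\<lambda>_. 1"]
      diff_upto_sum_affine[OF diff_upto_flat[of n 1], where L="{()}" and b="\<lambda>_. 1" and x="1" and r="\<lambda>_. - 1"] by simp_all
  then show "smooth1 ?f" unfolding smooth1_def by (intro allI diff_upto_mult)
qed (auto simp: flat_def)

definition bump :: "real \<Rightarrow> real" where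
  "bump = (SOME \<psi>. smooth1 \<psi> \<and> (\<forall>t. \<bar>t\<bar> < 1 \<longrightarrow> \<psi> t > 0) \<and> (\<forall>t. \<bar>t\<bar> \<ge> 1 \<longrightarrow> \<psi> t = 0))"

lemma bump: "smooth1 bump" "\<And>t. \<bar>t\<bar> < 1 \<Longrightarrow> bump t > 0" "\<And>t. \<bar>t\<bar> \<ge> 1 \<Longrightarrow> bump t = 0"
proof -
  have "\<exists>\<psi>. smooth1 \<psi> \<and> (\<forall>t. \<bar>t\<bar> < 1 \<longrightarrow> \<psi> t > 0) \<and> (\<forall>t. \<bar>t\<bar> \<ge> 1 \<longrightarrow> \<psi> t = 0)"
    by (meson smooth_bump_exists)
  from someI_ex[OF this]
  show "smooth1 bump" "\<And>t. \<bar>t\<bar> < 1 \<Longrightarrow> bump t > 0" "\<And>t. \<bar>t\<bar> \<ge> 1 \<Longrightarrow> bump t = 0"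
    by (auto simp: bump_def)
qed

lemma bump_nonneg: "bump t \<ge> 0"
  using bump(2,3)[of t] by (cases "\<bar>t\<bar> < 1") auto

text \<open>The inequality is strict, unlike the one for \<open>bump\<close> itself, because the
  induction step differentiates and so needs an open set of zeros.\<close>

lemma higher_deriv_bump_eq_0: "\<bar>t\<bar> > 1 \<Longrightarrow> (deriv ^^ a) bump t = 0"
proof (induction a arbitrary: t)
  case (Suc a)
  have "open {s::real. \<bar>s\<bar> > 1}" by (intro open_Collect_less continuous_intros)
  then have "((deriv ^^ a) bump has_real_derivative 0) (at t)"
    using Suc by (intro has_field_derivative_transform_within_open[OF DERIV_const[of 0], of "{s. \<bar>s\<bar> > 1}"]) auto
  then show ?case by (simp add: DERIV_imp_deriv)
qed (simp add: bump)

lemma higher_deriv_bump_bounded: obtains M where "M \<ge> 0" "\<And>t. \<bar>(deriv ^^ a) bump t\<bar> \<le> M"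
proof -
  have "bounded ((deriv ^^ a) bump ` {-1..1})"
    by (intro compact_imp_bounded compact_continuous_image smooth1_continuous
        smooth1_higher_deriv bump) auto
  then obtain M where M: "\<And>t. t \<in> {-1..1} \<Longrightarrow> \<bar>(deriv ^^ a) bump t\<bar> \<le> M"
    by (force simp: bounded_iff)
  show ?thesis
  proof (rule that[of "\<bar>M\<bar>"])
    fix t show "\<bar>(deriv ^^ a) bump t\<bar> \<le> \<bar>M\<bar>"
      using M[of t] higher_deriv_bump_eq_0[of t a] by (cases "\<bar>t\<bar> > 1") (force simp: abs_le_iff)+
  qed simp
qed

subsection \<open>Richardson extrapolation\<close>

text \<open>The polynomial has the value \<open>1\<close> at \<open>1\<close> and vanishes at \<open>2\<^sup>-\<^sup>1, \<dots>, 2\<^sup>-\<^sup>q\<close>, so that its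
  coefficients, used as weights at the nodes \<open>2\<^sup>-\<^sup>l\<close>, annihilate the monomials of degrees
  \<open>1, \<dots>, q\<close>.\<close>

definition richardson :: "nat \<Rightarrow> nat \<Rightarrow> real" where
  "richardson q = coeff (\<Prod>k=1..q. smult (1 / ((1/2) ^ k - 1)) [:(1/2) ^ k, -1:])"

text \<open>Exchanging the exponents \<open>l\<close> and \<open>k\<close> turns the
  \<open>k\<close>-th moment of the weights into the value of the polynomial at
  \<open>(1/2) ^ k\<close>.\<close>

lemma richardson_moments:
  assumes "k \<le> q"
  shows "(\<Sum>l\<le>q. richardson q l * ((1/2) ^ l) ^ k) = (if k = 0 then 1 else 0)"
proof -
  let ?P = "\<Prod>k=1..q. smult (1 / ((1/2) ^ k - 1)) [:(1/2) ^ k, -1 :: real:]"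
  \<comment> \<open>Each factor is linear, so the sum over \<open>l \<le> q\<close> contains all
    nonzero coefficients.\<close>
  have "degree ?P \<le> (\<Sum>k=1..q. 1)"
    by (rule order.trans[OF degree_prod_sum_le sum_mono]) (auto simp: degree_smult_eq)
  then have "(\<Sum>l\<le>q. richardson q l * x ^ l) = poly ?P x" for x
    unfolding poly_altdef richardson_def
    by (intro sum.mono_neutral_right) (auto intro: le_degree)
  from this[of "(1/2) ^ k"]
  have "(\<Sum>l\<le>q. richardson q l * ((1/2) ^ l) ^ k) = poly ?P ((1/2) ^ k)"
    by (simp flip: power_mult add: mult.commute)
  also have "\<dots> = (if k = 0 then 1 else 0)"
  proof (cases "k = 0")
    case True
    have "(1/2::real) ^ i \<noteq> 1" if "i \<ge> 1" for i
      using power_strict_decreasing[of 0 i "1/2::real"] that by simp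
    then show ?thesis using True by (auto simp: poly_prod field_simps intro!: prod.neutral)
  next
    case False
    then show ?thesis using assms by (auto simp: poly_prod intro!: bexI[of _ k])
  qed
  finally show ?thesis .
qed

text \<open>The l1 norm of the weights: the factor by which the combination may amplify errors in
  the values at the nodes.\<close>

definition richardson_norm :: "nat \<Rightarrow> real" where
  "richardson_norm q = (\<Sum>l\<le>q. \<bar>richardson q l\<bar>)"

text \<open>The weights have sum \<open>1\<close>. The bound allows lower powers of the norm to be
  absorbed into higher ones.\<close>

lemma richardson_norm_ge_1: "richardson_norm q \<ge> 1"
  using richardson_moments[of 0 q] sum_abs[of "richardson q" "{..q}"]
  by (simp add: richardson_norm_def)

section \<open>Taylor expansion and extrapolation in one variable\<close>

lemma Taylor_bound:
  fixes Df :: "nat \<Rightarrow> real \<Rightarrow> complex"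
  assumes "m > 0" "0 \<le> b"
    and Df: "\<And>i t. i < m \<Longrightarrow> 0 \<le> t \<Longrightarrow> t \<le> b \<Longrightarrow>
      (Df i has_vector_derivative Df (Suc i) t) (at t within {0..b})"
    and M: "\<And>t. 0 \<le> t \<Longrightarrow> t \<le> b \<Longrightarrow> cmod (Df m t) \<le> M"
  shows "cmod (Df 0 b - (\<Sum>i<m. (b ^ i / fact i) *\<^sub>R Df i 0)) \<le> b ^ m * M"
proof -
  have "M \<ge> 0" using M[of 0] assms(2) norm_ge_zero[of "Df m 0"] by linarith
  \<comment> \<open>The values are complex, so the remainder is taken in integral form; its kernel
    is bounded by \<open>b ^ (m - 1)\<close>, and the length of the interval supplies the last
    factor \<open>b\<close>.\<close>
  have "((\<lambda>x. ((b - x) ^ (m - 1) / fact (m - 1)) *\<^sub>R Df m x) has_integral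
      Df 0 b - (\<Sum>i<m. ((b - 0) ^ i / fact i) *\<^sub>R Df i 0)) (cbox 0 b)"
    using Taylor_has_integral[of m Df "Df 0" 0 b] assms by (simp add: cbox_interval)
  then have "cmod (Df 0 b - (\<Sum>i<m. ((b - 0) ^ i / fact i) *\<^sub>R Df i 0)) \<le> (b ^ (m - 1) * M) * measure lborel (cbox 0 b)"
  proof (rule has_integral_bound[rotated])
    fix x assume x: "x \<in> cbox 0 b"
    have "(b - x) ^ (m - 1) / fact (m - 1) \<le> (b - x) ^ (m - 1)"
      using x fact_ge_1[of "m - 1", where 'a = real]
      by (intro divide_le_eq_1[THEN iffD2] mult_imp_div_pos_le) (auto simp: mult_le_cancel_left1)
    also have "\<dots> \<le> b ^ (m - 1)" using x by (intro power_mono) auto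
    finally have "(b - x) ^ (m - 1) / fact (m - 1) * cmod (Df m x) \<le> b ^ (m - 1) * M"
      using x M[of x] assms(2) by (intro mult_mono) auto
    then show "norm (((b - x) ^ (m - 1) / fact (m - 1)) *\<^sub>R Df m x) \<le> b ^ (m - 1) * M"
      using x by simp
  qed (use \<open>M \<ge> 0\<close> assms in auto)
  also have "(b ^ (m - 1) * M) * measure lborel (cbox 0 b) = b ^ m * M"
    using assms by (cases m) auto
  finally show ?thesis by simp
qed

text \<open>On the Taylor polynomial, of degree \<open>m - 1 \<le> q\<close>, the weights return the
  constant term, since the nodes \<open>h * (1/2) ^ l\<close> turn the sums into moments. Only the
  remainders are left, amplified by at most \<open>richardson_norm q\<close>. That \<open>m\<close>
  may be smaller than \<open>Suc q\<close> is what later allows \<open>m\<close> to be fixed while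
  \<open>q\<close> grows.\<close>

lemma richardson_error:
  fixes Df :: "nat \<Rightarrow> real \<Rightarrow> complex"
  assumes "m > 0" "0 \<le> h" "m \<le> Suc q"
    and Df: "\<And>i t. i < m \<Longrightarrow> 0 \<le> t \<Longrightarrow> t \<le> h \<Longrightarrow>
      (Df i has_vector_derivative Df (Suc i) t) (at t within {0..h})"
    and M: "\<And>t. 0 \<le> t \<Longrightarrow> t \<le> h \<Longrightarrow> cmod (Df m t) \<le> M"
  shows "cmod ((\<Sum>l\<le>q. of_real (richardson q l) * Df 0 (h * (1/2) ^ l)) - Df 0 0)
     \<le> richardson_norm q * (h ^ m * M)"
proof -
  have M0: "M \<ge> 0" using M[of 0] assms(2) norm_ge_zero[of "Df m 0"] by linarith
  define T where "T b = (\<Sum>i<m. (b ^ i / fact i) *\<^sub>R Df i 0)" for b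
  have T: "cmod (Df 0 (h * (1/2) ^ l) - T (h * (1/2) ^ l)) \<le> h ^ m * M" for l
  proof -
    have le: "h * (1/2) ^ l \<le> h" using assms(2) by (simp add: mult_left_le power_le_one)
    have "cmod (Df 0 (h * (1/2) ^ l) - T (h * (1/2) ^ l)) \<le> (h * (1/2) ^ l) ^ m * M"
      unfolding T_def
    proof (rule Taylor_bound)
      fix i t assume "i < m" "0 \<le> t" "t \<le> h * (1/2) ^ l"
      then show "(Df i has_vector_derivative Df (Suc i) t) (at t within {0..h * (1/2) ^ l})"
        using le by (intro has_vector_derivative_within_subset[OF Df]) auto
    qed (use assms le M in auto)
    also have "\<dots> \<le> h ^ m * M" using le assms(2) M0 by (intro mult_right_mono power_mono) auto
    finally show ?thesis .
  qed
  have "(\<Sum>l\<le>q. of_real (richardson q l) * T (h * (1/2) ^ l))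
      = (\<Sum>i<m. (h ^ i / fact i * (\<Sum>l\<le>q. richardson q l * ((1/2) ^ l) ^ i)) *\<^sub>R Df i 0)"
    unfolding T_def sum_distrib_left scaleR_conv_of_real of_real_sum sum_distrib_right
    by (subst sum.swap) (simp add: power_mult_distrib mult_ac)
  also have "\<dots> = (\<Sum>i<m. if i = 0 then Df 0 0 else 0)"
    using assms(3) by (intro sum.cong) (auto simp: richardson_moments)
  also have "\<dots> = Df 0 0" using assms(1) by simp
  finally have "(\<Sum>l\<le>q. of_real (richardson q l) * Df 0 (h * (1/2) ^ l)) - Df 0 0
     = (\<Sum>l\<le>q. of_real (richardson q l) * (Df 0 (h * (1/2) ^ l) - T (h * (1/2) ^ l)))"
    by (simp add: right_diff_distrib sum_subtractf)
  also have "cmod \<dots> \<le> (\<Sum>l\<le>q. \<bar>richardson q l\<bar> * (h ^ m * M))"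
    using T by (intro sum_norm_le) (auto simp: norm_mult intro!: mult_left_mono)
  finally show ?thesis by (simp add: richardson_norm_def sum_distrib_right)
qed

subsection \<open>Partial derivatives\<close>

lemma partial_D_frechet:
  assumes "f differentiable at y"
  shows "partial_D i f y = frechet_derivative f (at y) (axis i 1)"
proof -
  have "(f has_derivative frechet_derivative f (at y)) (at (y + 0 *\<^sub>R axis i 1))"
    using assms by (simp add: frechet_derivative_works)
  then have "((\<lambda>t. f (y + t *\<^sub>R axis i 1)) has_derivative
      (\<lambda>t. frechet_derivative f (at y) (t *\<^sub>R axis i 1))) (at 0)"
    by (rule has_derivative_compose[rotated]) (auto intro!: derivative_eq_intros)
  moreover have "(\<lambda>t. frechet_derivative f (at y) (t *\<^sub>R axis i 1))
      = (\<lambda>t. t *\<^sub>R frechet_derivative f (at y) (axis i 1))"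
    using linear_frechet_derivative[OF assms] by (simp add: linear_scale)
  ultimately show ?thesis
    unfolding partial_D_def by (simp add: has_vector_derivative_def vector_derivative_at)
qed

lemma has_vector_derivative_along_axis:
  assumes "f differentiable at (p + (t * c) *\<^sub>R axis k 1)"
  shows "((\<lambda>s. f (p + (s * c) *\<^sub>R axis k 1)) has_vector_derivative
     of_real c * partial_D k f (p + (t * c) *\<^sub>R axis k 1)) (at t within S)"
proof -
  let ?y = "p + (t * c) *\<^sub>R axis k 1"
  have "(f has_derivative frechet_derivative f (at ?y)) (at ?y)"
    using assms by (simp add: frechet_derivative_works)
  then have "((\<lambda>s. f (p + (s * c) *\<^sub>R axis k 1)) has_derivative
      (\<lambda>s. frechet_derivative f (at ?y) ((s * c) *\<^sub>R axis k 1))) (at t within S)"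
    by (rule has_derivative_compose[rotated]) (auto intro!: derivative_eq_intros)
  moreover have "(\<lambda>s. frechet_derivative f (at ?y) ((s * c) *\<^sub>R axis k 1))
      = (\<lambda>s. s *\<^sub>R (of_real c * partial_D k f ?y))"
    unfolding partial_D_frechet[OF assms] linear_scale[OF linear_frechet_derivative[OF assms]]
    by (simp add: scaleR_conv_of_real[where 'a = complex] mult.assoc)
  ultimately show ?thesis by (simp add: has_vector_derivative_def)
qed

text \<open>The equation for \<open>h\<close> is required on \<Omega> only, as values elsewhere are
  junk and derivatives on an open set are local. Besides sums and differences this covers, with
  \<open>a = 1\<close> and \<open>b = 0\<close>, functions that merely agree on \<Omega>.\<close>

lemma partial_D_lincomb:
  assumes "open \<Omega>" "f differentiable_on \<Omega>" "g differentiable_on \<Omega>"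
    and h: "\<And>x. x \<in> \<Omega> \<Longrightarrow> h x = a * f x + b * g x"
  shows "h differentiable_on \<Omega>"
    and "x \<in> \<Omega> \<Longrightarrow> partial_D i h x = a * partial_D i f x + b * partial_D i g x"
proof -
  have D: "(h has_derivative (\<lambda>v. a * frechet_derivative f (at x) v + b * frechet_derivative g (at x) v)) (at x)"
    if "x \<in> \<Omega>" for x
  proof -
    have "(f has_derivative frechet_derivative f (at x)) (at x)"
      "(g has_derivative frechet_derivative g (at x)) (at x)"
      using assms that by (auto simp: differentiable_on_eq_differentiable_at frechet_derivative_works)
    then have "((\<lambda>x. a * f x + b * g x) has_derivative
        (\<lambda>v. a * frechet_derivative f (at x) v + b * frechet_derivative g (at x) v)) (at x)"
      by (auto intro!: derivative_eq_intros)
    then show ?thesis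
      by (rule has_derivative_transform_within_open[OF _ assms(1) that]) (simp add: h)
  qed
  then show "h differentiable_on \<Omega>"
    by (auto simp: assms(1) differentiable_on_eq_differentiable_at differentiable_def)
  show "partial_D i h x = a * partial_D i f x + b * partial_D i g x" if "x \<in> \<Omega>"
  proof -
    have "f differentiable at x" "g differentiable at x" "h differentiable at x"
      using assms(1-3) that D[OF that] by (auto simp: differentiable_on_eq_differentiable_at differentiable_def)
    then show ?thesis
      by (simp only: partial_D_frechet frechet_derivative_at[OF D[OF that], THEN fun_cong, symmetric])
  qed
qed

lemma C_k_lincomb:
  assumes "open \<Omega>"
  shows "C_k k \<Omega> f \<Longrightarrow> C_k k \<Omega> g \<Longrightarrow> (\<And>x. x \<in> \<Omega> \<Longrightarrow> h x = a * f x + b * g x) \<Longrightarrow> C_k k \<Omega> h"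
proof (induction k arbitrary: f g h)
  case 0
  then have "continuous_on \<Omega> (\<lambda>x. a * f x + b * g x)"
    by (intro continuous_intros) auto
  then show ?case
    using 0 continuous_on_cong[of \<Omega> \<Omega> h "\<lambda>x. a * f x + b * g x"] by simp
next
  case (Suc k)
  have *: "f differentiable_on \<Omega>" "g differentiable_on \<Omega>" using Suc.prems by simp_all
  have "C_k k \<Omega> (partial_D i h)" for i
  proof (rule Suc.IH[of "partial_D i f" "partial_D i g"])
    show "partial_D i h x = a * partial_D i f x + b * partial_D i g x" if "x \<in> \<Omega>" for x
      using partial_D_lincomb(2)[OF assms * _ that, of h a b] Suc.prems(3) by blast
  qed (use Suc.prems in simp_all)
  then show ?case
    using partial_D_lincomb(1)[OF assms * Suc.prems(3)] by simp
qed

lemma C_k_subset: "C_k k \<Omega> f \<Longrightarrow> \<Omega>' \<subseteq> \<Omega> \<Longrightarrow> C_k k \<Omega>' f"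
  by (induction k arbitrary: f) (auto intro: continuous_on_subset differentiable_on_subset)

lemma C_infinity_subset: "f \<in> C_infinity \<Omega> \<Longrightarrow> \<Omega>' \<subseteq> \<Omega> \<Longrightarrow> f \<in> C_infinity \<Omega>'"
  by (auto simp: C_infinity_def intro: C_k_subset)

lemma C_infinity_lincomb:
  "open \<Omega> \<Longrightarrow> f \<in> C_infinity \<Omega> \<Longrightarrow> g \<in> C_infinity \<Omega> \<Longrightarrow> (\<And>x. x \<in> \<Omega> \<Longrightarrow> h x = a * f x + b * g x)
    \<Longrightarrow> h \<in> C_infinity \<Omega>"
  unfolding C_infinity_def by (auto intro: C_k_lincomb)

lemma C_infinity_continuous: "f \<in> C_infinity \<Omega> \<Longrightarrow> continuous_on \<Omega> f"
  by (auto simp: C_infinity_def dest: spec[of _ 0])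

lemma C_infinity_differentiable: "f \<in> C_infinity \<Omega> \<Longrightarrow> f differentiable_on \<Omega>"
  by (auto simp: C_infinity_def dest: spec[of _ "Suc 0"])

lemma C_infinity_partial_D: "f \<in> C_infinity \<Omega> \<Longrightarrow> partial_D i f \<in> C_infinity \<Omega>"
proof -
  assume "f \<in> C_infinity \<Omega>"
  then have "C_k (Suc k) \<Omega> f" for k by (simp add: C_infinity_def del: C_k.simps)
  then show ?thesis by (simp add: C_infinity_def)
qed

lemma C_infinity_funpow_partial_D: "f \<in> C_infinity \<Omega> \<Longrightarrow> (partial_D i ^^ k) f \<in> C_infinity \<Omega>"
  by (induction k) (auto intro: C_infinity_partial_D)

lemma C_infinity_foldr: "f \<in> C_infinity \<Omega> \<Longrightarrow> foldr (\<lambda>i. partial_D i ^^ \<alpha> i) is f \<in> C_infinity \<Omega>"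
  by (induction "is") (auto intro: C_infinity_funpow_partial_D)

lemma C_infinity_multi_D: "f \<in> C_infinity \<Omega> \<Longrightarrow> multi_D \<alpha> f \<in> C_infinity \<Omega>"
  unfolding multi_D_def by (rule C_infinity_foldr)

lemma multi_D_lincomb:
  assumes "open \<Omega>" "f \<in> C_infinity \<Omega>" "g \<in> C_infinity \<Omega>"
    and "\<And>x. x \<in> \<Omega> \<Longrightarrow> h x = a * f x + b * g x" and "x \<in> \<Omega>"
  shows "multi_D \<alpha> h x = a * multi_D \<alpha> f x + b * multi_D \<alpha> g x"
proof -
  \<comment> \<open>This relation is stable under every \<open>partial_D i\<close>, hence under all
    iterated derivatives; it includes smoothness because each step needs differentiability.\<close>
  define L where "L f g h \<longleftrightarrow> f \<in> C_infinity \<Omega> \<and> g \<in> C_infinity \<Omega> \<and> (\<forall>x\<in>\<Omega>. h x = a * f x + b * g x)" for f g h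
  have 1: "L (partial_D i f) (partial_D i g) (partial_D i h)" if "L f g h" for i f g h
    using that by (auto simp: L_def C_infinity_partial_D C_infinity_differentiable
        intro!: partial_D_lincomb(2)[OF assms(1)])
  have 2: "L ((partial_D i ^^ k) f) ((partial_D i ^^ k) g) ((partial_D i ^^ k) h)"
    if "L f g h" for i f g h k
    by (induction k) (simp_all add: 1 that)
  have "L (foldr (\<lambda>i. partial_D i ^^ \<alpha> i) is f) (foldr (\<lambda>i. partial_D i ^^ \<alpha> i) is g)
      (foldr (\<lambda>i. partial_D i ^^ \<alpha> i) is h)" if "L f g h" for "is"
    by (induction "is") (simp_all add: 2 that)
  moreover have "L f g h" using assms by (simp add: L_def)
  ultimately show ?thesis using assms(5) by (simp add: multi_D_def L_def)
qed

lemma coords: "distinct (coords :: 'n::finite list)" "set (coords :: 'n list) = UNIV"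
proof -
  have "\<exists>is. distinct is \<and> set is = (UNIV :: 'n set)" using finite_distinct_list[of "UNIV :: 'n set"] by auto
  from someI_ex[OF this] show "distinct (coords :: 'n list)" "set (coords :: 'n list) = UNIV"
    by (auto simp: coords_def)
qed

lemma multi_D_0: "multi_D (\<lambda>_. 0) f = f"
proof -
  have "foldr (\<lambda>i. partial_D i ^^ 0) is f = f" for "is" by (induction "is") auto
  then show ?thesis by (simp add: multi_D_def)
qed

text \<open>Extracts bounds on pure derivatives, the only ones in the error estimate, from bounds
  stated for multi-indices.\<close>

lemma multi_D_single: "multi_D (\<lambda>i. if i = k then m else 0) f = (partial_D k ^^ m) f"
proof -
  have "distinct is \<Longrightarrow> foldr (\<lambda>i. partial_D i ^^ (if i = k then m else 0)) is f
      = (if k \<in> set is then (partial_D k ^^ m) f else f)" for "is"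
    by (induction "is") auto
  from this[OF coords(1)] show ?thesis by (simp add: multi_D_def coords(2))
qed

lemma sup_D_upper:
  assumes "f \<in> C_infinity \<Omega>" "compact K" "K \<subseteq> \<Omega>" "x \<in> K"
  shows "cmod (multi_D \<alpha> f x) \<le> sup_D K \<alpha> f"
proof -
  have "continuous_on K (\<lambda>x. cmod (multi_D \<alpha> f x))"
    using continuous_on_subset[OF C_infinity_continuous[OF C_infinity_multi_D[OF assms(1)]] assms(3)]
    by (rule continuous_on_norm)
  then have "bdd_above ((\<lambda>x. cmod (multi_D \<alpha> f x)) ` K)"
    using assms by (intro bounded_imp_bdd_above compact_imp_bounded compact_continuous_image)
  then show ?thesis unfolding sup_D_def using assms by (intro cSUP_upper)
qed

lemma sup_D_least: "K \<noteq> {} \<Longrightarrow> (\<And>x. x \<in> K \<Longrightarrow> cmod (multi_D \<alpha> f x) \<le> B) \<Longrightarrow> sup_D K \<alpha> f \<le> B"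
  unfolding sup_D_def by (rule cSUP_least)

lemma sup_D_nonneg:
  assumes "f \<in> C_infinity \<Omega>" "compact K" "K \<subseteq> \<Omega>" "K \<noteq> {}"
  shows "sup_D K \<alpha> f \<ge> 0"
proof -
  obtain x where "x \<in> K" using assms by auto
  from sup_D_upper[OF assms(1-3) this, of \<alpha>] show ?thesis
    using norm_ge_zero[of "multi_D \<alpha> f x"] by linarith
qed

subsection \<open>Tensor products\<close>

definition tens :: "('n::finite \<Rightarrow> real \<Rightarrow> real) \<Rightarrow> real^'n \<Rightarrow> complex" where
  "tens g y = of_real (\<Prod>i\<in>UNIV. g i (y $ i))"

lemma partial_D_tens:
  assumes "\<And>i. smooth1 (g i)"
  shows "partial_D k (tens g) = tens (g(k := deriv (g k)))"
proof
  fix x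
  let ?c = "\<Prod>i\<in>UNIV - {k}. g i (x $ i)"
  have prod: "(\<Prod>i\<in>UNIV. G i) = G k * (\<Prod>i\<in>UNIV - {k}. G i)" for G :: "'a \<Rightarrow> real"
    by (simp add: prod.remove)
  have "((\<lambda>t. g k (x $ k + t) * ?c) has_real_derivative deriv (g k) (x $ k) * ?c) (at 0)"
    by (auto intro!: derivative_eq_intros DERIV_chain2[of "g k"] smooth1_DERIV assms)
  then have "((\<lambda>t. complex_of_real (g k (x $ k + t) * ?c)) has_vector_derivative
      of_real (deriv (g k) (x $ k) * ?c)) (at 0)"
    by (intro has_vector_derivative_of_real) (simp add: has_real_derivative_iff_has_vector_derivative)
  moreover have "(\<lambda>t. complex_of_real (g k (x $ k + t) * ?c)) = (\<lambda>t. tens g (x + t *\<^sub>R axis k 1))"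
    by (auto simp: tens_def prod axis_def intro!: prod.cong)
  ultimately show "partial_D k (tens g) x = tens (g(k := deriv (g k))) x"
    by (simp add: partial_D_def vector_derivative_at tens_def prod)
qed

lemma tens_differentiable:
  assumes "\<And>i. smooth1 (g i)"
  shows "tens g differentiable at x"
proof -
  have "((\<lambda>y. g i (y $ i)) has_derivative (\<lambda>v. deriv (g i) (x $ i) * v $ i)) (at x)" for i
    using assms[of i, THEN smooth1_DERIV, of "x $ i"] unfolding has_field_derivative_def
    by (rule has_derivative_compose[rotated]) (auto intro!: derivative_eq_intros bounded_linear_imp_has_derivative)
  from has_derivative_prod[of UNIV "\<lambda>i y. g i (y $ i)", OF this]
  have "(\<lambda>y. \<Prod>i\<in>UNIV. g i (y $ i)) differentiable at x"
    by (auto simp: differentiable_def)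
  then obtain D where "((\<lambda>y. \<Prod>i\<in>UNIV. g i (y $ i)) has_derivative D) (at x)"
    by (auto simp: differentiable_def)
  from has_derivative_of_real[OF this, where 'a = complex] show ?thesis
    unfolding tens_def[abs_def] by (auto simp: differentiable_def)
qed

lemma tens_C_infinity:
  assumes "\<And>i. smooth1 (g i)"
  shows "tens g \<in> C_infinity \<Omega>"
proof -
  have "C_k k \<Omega> (tens g)" for k
    using assms
  proof (induction k arbitrary: g)
    case 0
    then show ?case
      by (auto intro!: differentiable_imp_continuous_on differentiable_at_imp_differentiable_on tens_differentiable)
  next
    case (Suc k)
    have "C_k k \<Omega> (partial_D i (tens g))" for i
      unfolding partial_D_tens[OF Suc.prems] using Suc.prems by (intro Suc.IH) (auto intro: smooth1_deriv)
    then show ?case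
      using Suc.prems by (auto intro!: differentiable_at_imp_differentiable_on tens_differentiable)
  qed
  then show ?thesis by (simp add: C_infinity_def)
qed

lemma funpow_partial_D_tens:
  "(\<And>i. smooth1 (g i)) \<Longrightarrow> (partial_D k ^^ m) (tens g) = tens (g(k := (deriv ^^ m) (g k)))"
  by (induction m) (auto simp: partial_D_tens smooth1_higher_deriv)

lemma multi_D_tens:
  assumes "\<And>i. smooth1 (g i)"
  shows "multi_D \<alpha> (tens g) = tens (\<lambda>i. (deriv ^^ \<alpha> i) (g i))"
proof -
  \<comment> \<open>For a sublist, exactly its own coordinates have been differentiated;
    distinctness ensures that the next one is still untouched.\<close>
  have "distinct is \<Longrightarrow> foldr (\<lambda>i. partial_D i ^^ \<alpha> i) is (tens g)
      = tens (\<lambda>i. if i \<in> set is then (deriv ^^ \<alpha> i) (g i) else g i)" for "is"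
  proof (induction "is")
    case (Cons a "is")
    then have "foldr (\<lambda>i. partial_D i ^^ \<alpha> i) (a # is) (tens g)
      = (partial_D a ^^ \<alpha> a) (tens (\<lambda>i. if i \<in> set is then (deriv ^^ \<alpha> i) (g i) else g i))"
      by simp
    also have "\<dots> = tens ((\<lambda>i. if i \<in> set is then (deriv ^^ \<alpha> i) (g i) else g i)
        (a := (deriv ^^ \<alpha> a) (if a \<in> set is then (deriv ^^ \<alpha> a) (g a) else g a)))"
      by (intro funpow_partial_D_tens) (auto intro: smooth1_higher_deriv assms)
    also have "\<dots> = tens (\<lambda>i. if i \<in> set (a # is) then (deriv ^^ \<alpha> i) (g i) else g i)"
      using Cons.prems by (intro arg_cong[of _ _ tens]) auto
    finally show ?case .
  qed simp
  from this[OF coords(1)] show ?thesis by (simp add: multi_D_def coords(2))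
qed

subsection \<open>The approximation formula\<close>

lemma Basis_cart: "(Basis :: (real^'n) set) = range (\<lambda>i. axis i 1)"
  by (auto simp: Basis_vec_def)

lemma inj_axis_1: "inj (\<lambda>i. axis i (1::real))"
  by (auto simp: inj_def axis_eq_axis)

text \<open>The scaling differs from coordinate to coordinate because expanding the tensor product
  yields bumps dilated independently in each direction.\<close>

lemma lborel_integral_affine_cart:
  fixes F :: "real^'n::finite \<Rightarrow> 'b::{banach, second_countable_topology}"
  assumes [measurable]: "F \<in> borel_measurable borel" and c: "\<And>i. c i > 0"
  shows "(LINT y|lborel. F y) = (\<Prod>i\<in>UNIV. c i) *\<^sub>R (LINT z|lborel. F (x + (\<chi> i. c i * z $ i)))"
proof -
  let ?c = "\<chi> i. c i"
  define T where "T z = x + (\<Sum>j\<in>Basis. ((?c \<bullet> j) * (z \<bullet> j)) *\<^sub>R j)" for z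
  have T: "T z = x + (\<chi> i. c i * z $ i)" for z
  proof -
    have "(\<Sum>j\<in>Basis. ((?c \<bullet> j) * (z \<bullet> j)) *\<^sub>R j) = (\<Sum>i\<in>UNIV. (c i * z $ i) *\<^sub>R axis i 1)"
      unfolding Basis_cart sum.reindex[OF inj_axis_1] by (simp add: inner_axis)
    then show ?thesis
      by (simp add: T_def vec_eq_iff axis_def if_distrib cong: if_cong)
  qed
  have [measurable]: "T \<in> borel_measurable borel" unfolding T_def[abs_def] by measurable
  have prod: "(\<Prod>j\<in>(Basis :: (real^'n) set). \<bar>?c \<bullet> j\<bar>) = (\<Prod>i\<in>UNIV. c i)"
    using c by (simp add: Basis_cart prod.reindex[OF inj_axis_1] inner_axis less_imp_le)
  have "?c \<bullet> j \<noteq> 0" if "j \<in> Basis" for j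
    using that c by (auto simp: Basis_cart inner_axis less_imp_neq[symmetric])
  from lborel_affine_euclidean[of "\<lambda>j. ?c \<bullet> j" x, OF this]
  have "lborel = density (distr lborel borel T) (\<lambda>_. \<Prod>i\<in>UNIV. c i)"
    by (simp add: T_def[abs_def] prod)
  then have "(LINT y|lborel. F y) = (LINT y|density (distr lborel borel T) (\<lambda>_. \<Prod>i\<in>UNIV. c i). F y)"
    by simp
  also have "\<dots> = (LINT y|distr lborel borel T. (\<Prod>i\<in>UNIV. c i) *\<^sub>R F y)"
    using c by (subst integral_density) (auto intro: prod_nonneg less_imp_le)
  also have "\<dots> = (LINT z|lborel. (\<Prod>i\<in>UNIV. c i) *\<^sub>R F (T z))"
    by (subst integral_distr) auto
  finally show ?thesis by (simp add: T)
qed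

definition bumps :: "real^'n::finite \<Rightarrow> real" where
  "bumps z = (\<Prod>i\<in>UNIV. bump (z $ i))"

lemma bumps_nonneg: "bumps z \<ge> 0"
  by (simp add: bumps_def prod_nonneg bump_nonneg)

lemma bumps_eq_0: "\<bar>z $ i\<bar> > 1 \<Longrightarrow> bumps z = 0"
  unfolding bumps_def by (rule prod_zero) (auto intro!: exI[of _ i] bump)

lemma continuous_bumps: "continuous_on S bumps"
  unfolding bumps_def[abs_def]
  by (intro continuous_on_prod continuous_on_compose2[OF smooth1_continuous[OF bump(1), of UNIV]])
    (auto intro!: continuous_intros)

definition ucube :: "(real^'n::finite) set" where
  "ucube = cbox (\<chi> i. -1) (\<chi> i. 1)"

lemma mem_ucube: "z \<in> ucube \<longleftrightarrow> (\<forall>i. \<bar>z $ i\<bar> \<le> 1)"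
  by (simp add: ucube_def mem_box_cart abs_le_iff) (metis minus_le_iff)

text \<open>Continuity is asked for on the cube only: \<open>F\<close> will be a function on
  \<Omega> composed with a map known to stay in \<Omega> just there. Outside the cube
  \<open>bumps\<close> vanishes.\<close>

lemma bumps_times_integrable:
  fixes F :: "real^'n::finite \<Rightarrow> 'b::{banach, second_countable_topology}"
  assumes "continuous_on ucube F"
  shows "integrable lborel (\<lambda>z. bumps z *\<^sub>R F z)"
proof -
  have "integrable lborel (\<lambda>z. indicator ucube z *\<^sub>R (bumps z *\<^sub>R F z))"
    by (intro borel_integrable_compact continuous_intros assms continuous_bumps)
      (simp add: ucube_def)
  also have "(\<lambda>z. indicator ucube z *\<^sub>R (bumps z *\<^sub>R F z)) = (\<lambda>z. bumps z *\<^sub>R F z)"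
    using bumps_eq_0 by (fastforce simp: indicator_def mem_ucube not_le)
  finally show ?thesis .
qed

lemma bumps_integrable: "integrable lborel bumps"
  using bumps_times_integrable[of "\<lambda>_. 1 :: real"] by simp

text \<open>The normalising constant of the mollifiers. It is taken in all variables at once, so no
  integral has to be factored; it depends on the dimension only, hence the type argument.\<close>

definition bumps_int :: "'n::finite itself \<Rightarrow> real" where
  "bumps_int _ = (LINT z|lborel. bumps (z :: real^'n))"

text \<open>A nonnegative function with integral \<open>0\<close> vanishes almost everywhere, but
  \<open>bumps\<close> is positive on a nonempty open box.\<close>

lemma bumps_int_pos: "bumps_int TYPE('n::finite) > 0"
proof -
  let ?I = "LINT z|lborel. bumps (z :: real^'n)"
  have "?I \<noteq> 0"
  proof
    assume "?I = 0"
    then have "AE z in lborel. bumps (z :: real^'n) = 0"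
      using integral_nonneg_eq_0_iff_AE[OF bumps_integrable[where 'a = 'n]] by (simp add: bumps_nonneg)
    then have "AE z in lborel. (z :: real^'n) \<notin> box (\<chi> i. -1) (\<chi> i. 1)"
    proof eventually_elim
      case (elim z)
      show ?case
      proof
        assume "z \<in> box (\<chi> i. -1) (\<chi> i. 1)"
        then have "\<bar>z $ i\<bar> < 1" for i by (auto simp: mem_box_cart abs_less_iff minus_less_iff)
        then have "bumps z > 0" by (simp add: bumps_def prod_pos bump)
        then show False using elim by simp
      qed
    qed
    then have "emeasure lborel (box (\<chi> i. -1) (\<chi> i. 1) :: (real^'n) set) = 0"
      by (subst (asm) AE_iff_measurable[OF _ refl]) auto
    moreover have "negligible (box (\<chi> i. -1) (\<chi> i. 1) :: (real^'n) set)
        \<longleftrightarrow> emeasure lborel (box (\<chi> i. -1) (\<chi> i. 1) :: (real^'n) set) = 0"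
      by (simp add: negligible_iff_emeasure0)
    moreover have "(0 :: real^'n) \<in> box (\<chi> i. -1) (\<chi> i. 1)" by (simp add: mem_box_cart)
    ultimately show False using open_not_negligible[OF open_box] by blast
  qed
  moreover have "?I \<ge> 0" by (intro integral_nonneg_AE) (simp add: bumps_nonneg)
  ultimately show ?thesis by (simp add: bumps_int_def)
qed

text \<open>The Richardson combination of the dilated bumps: all its moments of orders \<open>1, \<dots>, q\<close>
  vanish.\<close>

definition kernel1 :: "nat \<Rightarrow> real \<Rightarrow> real \<Rightarrow> real \<Rightarrow> real" where
  "kernel1 q h x t = (\<Sum>l\<le>q. (richardson q l * (2 ^ l / h)) * bump ((t - x) * (2 ^ l / h)))"

definition mollifier :: "nat \<Rightarrow> real \<Rightarrow> real^'n::finite \<Rightarrow> real^'n \<Rightarrow> complex" where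
  "mollifier q h x y = of_real (1 / bumps_int TYPE('n)) * tens (\<lambda>i. kernel1 q h (x $ i)) y"

lemma smooth1_kernel1: "smooth1 (kernel1 q h x)"
  unfolding kernel1_def[abs_def] by (intro smooth1_sum_affine bump)

lemma kernel1_eq_0:
  assumes "h > 0" "\<bar>t - x\<bar> > h"
  shows "kernel1 q h x t = 0"
proof -
  \<comment> \<open>The widest dilate is the one for \<open>l = 0\<close>, of radius
    \<open>h\<close>.\<close>
  have "bump ((t - x) * (2 ^ l / h)) = 0" for l :: nat
  proof (rule bump(3))
    have "h * 1 \<le> \<bar>t - x\<bar> * 2 ^ l" using assms by (intro mult_mono) auto
    then have "1 \<le> \<bar>t - x\<bar> * (2 ^ l / h)" using assms by (simp add: le_divide_eq)
    then show "1 \<le> \<bar>(t - x) * (2 ^ l / h)\<bar>" using assms by (simp add: abs_mult)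
  qed
  then show ?thesis by (simp add: kernel1_def)
qed

lemma mollifier_eq_0: "h > 0 \<Longrightarrow> \<bar>y $ i - x $ i\<bar> > h \<Longrightarrow> mollifier q h x y = 0"
  unfolding mollifier_def tens_def
  by (auto intro!: exI[of _ i] kernel1_eq_0)

lemma mollifier_C_infinity:
  assumes "open \<Omega>"
  shows "mollifier q h x \<in> C_infinity \<Omega>"
proof -
  have "tens (\<lambda>i. kernel1 q h (x $ i)) \<in> C_infinity \<Omega>"
    by (intro tens_C_infinity smooth1_kernel1)
  from C_infinity_lincomb[OF assms this this, of _ "of_real (1 / bumps_int TYPE('a))" 0] show ?thesis
    by (simp add: mollifier_def[abs_def])
qed

lemma multi_D_mollifier:
  fixes x :: "real^'n::finite"
  shows "multi_D \<alpha> (mollifier q h x) y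
    = of_real (1 / bumps_int TYPE('n)) * tens (\<lambda>i. (deriv ^^ \<alpha> i) (kernel1 q h (x $ i))) y"
proof -
  have "multi_D \<alpha> (mollifier q h x) y
    = of_real (1 / bumps_int TYPE('n)) * multi_D \<alpha> (tens (\<lambda>i. kernel1 q h (x $ i))) y
      + 0 * multi_D \<alpha> (tens (\<lambda>i. kernel1 q h (x $ i))) y"
    by (rule multi_D_lincomb[of UNIV]) (auto simp: mollifier_def intro!: tens_C_infinity smooth1_kernel1)
  then show ?thesis by (simp add: multi_D_tens smooth1_kernel1)
qed

text \<open>Each derivative brings out a factor \<open>2 ^ l / h\<close>, and the normalisation of
  the dilate contributes one more, whence \<open>Suc a\<close>; the worst case is
  \<open>l = q\<close>.\<close>

lemma kernel1_higher_deriv_bound: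
  assumes "0 < h" "h \<le> 1" and M: "\<And>t. \<bar>(deriv ^^ a) bump t\<bar> \<le> M"
  shows "\<bar>(deriv ^^ a) (kernel1 q h x) t\<bar> \<le> richardson_norm q * (2 ^ q / h) ^ Suc a * M"
proof -
  have "\<bar>(deriv ^^ a) (kernel1 q h x) t\<bar>
      \<le> (\<Sum>l\<le>q. \<bar>richardson q l * (2 ^ l / h) * (2 ^ l / h) ^ a * (deriv ^^ a) bump ((t - x) * (2 ^ l / h))\<bar>)"
    unfolding kernel1_def[abs_def] higher_deriv_sum_affine[OF bump(1)] by (rule sum_abs)
  also have "\<dots> \<le> (\<Sum>l\<le>q. \<bar>richardson q l\<bar> * (2 ^ q / h) ^ Suc a * M)"
  proof (rule sum_mono)
    fix l assume "l \<in> {..q}"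
    then have "(2 ^ l / h) ^ Suc a \<le> (2 ^ q / h) ^ Suc a"
      using assms by (intro power_mono divide_right_mono power_increasing) auto
    then have "\<bar>richardson q l\<bar> * (2 ^ l / h) ^ Suc a * \<bar>(deriv ^^ a) bump ((t - x) * (2 ^ l / h))\<bar>
      \<le> \<bar>richardson q l\<bar> * (2 ^ q / h) ^ Suc a * M"
      using assms by (intro mult_mono M mult_left_mono) auto
    then show "\<bar>richardson q l * (2 ^ l / h) * (2 ^ l / h) ^ a * (deriv ^^ a) bump ((t - x) * (2 ^ l / h))\<bar>
      \<le> \<bar>richardson q l\<bar> * (2 ^ q / h) ^ Suc a * M"
      using assms by (simp add: abs_mult mult.assoc)
  qed
  finally show ?thesis unfolding richardson_norm_def sum_distrib_right .
qed

text \<open>Induction on the set \<open>S\<close> of extrapolated coordinates. Adding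
  \<open>k\<close> replaces each value at a node by a one-dimensional Richardson sum in direction
  \<open>k\<close>, at a cost of at most \<open>B\<close>; the outer weights have total absolute
  value \<open>richardson_norm q ^ card S\<close>.\<close>

lemma richardson_telescope:
  fixes f :: "real^'n::finite \<Rightarrow> complex" and S :: "'n set"
  assumes f: "f \<in> C_infinity \<Omega>" and "open \<Omega>"
    and Q: "\<And>y. (\<forall>i. \<bar>y $ i - x $ i\<bar> \<le> h) \<Longrightarrow> y \<in> \<Omega>"
    and M: "\<And>k y. (\<forall>i. \<bar>y $ i - x $ i\<bar> \<le> h) \<Longrightarrow> cmod ((partial_D k ^^ m) f y) \<le> M"
    and m: "0 < m" "m \<le> Suc q" and h: "0 \<le> h" and z: "\<And>i. \<bar>z $ i\<bar> \<le> 1"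
  shows "cmod ((\<Sum>j\<in>PiE S (\<lambda>_. {..q}). of_real (\<Prod>i\<in>S. richardson q (j i)) *
      f (x + (\<chi> i. if i \<in> S then h * (1/2) ^ j i * z $ i else 0))) - f x)
    \<le> real (card S) * richardson_norm q ^ card S * (richardson_norm q * (h ^ m * M))"
proof -
  let ?A = "richardson_norm q"
  define B where "B = ?A * (h ^ m * M)"
  have "M \<ge> 0" using M[of x] h by (force intro: order.trans[OF norm_ge_zero])
  then have "B \<ge> 0" using h richardson_norm_ge_1[of q] by (simp add: B_def)
  define P where "P S j = x + (\<chi> i. if i \<in> S then h * (1/2) ^ j i * z $ i else 0)" for S j
  define E where "E S = (\<Sum>j\<in>PiE S (\<lambda>_. {..q}). of_real (\<Prod>i\<in>S. richardson q (j i)) * f (P S j))" for S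
  have small: "\<bar>h * (1/2) ^ l * z $ i\<bar> \<le> h" for l i
  proof -
    have "(1/2::real) ^ l * \<bar>z $ i\<bar> \<le> 1" using z[of i] by (intro mult_le_one) (auto simp: power_le_one)
    then show ?thesis using h mult_left_le[of "(1/2) ^ l * \<bar>z $ i\<bar>" h] by (simp add: abs_mult mult.assoc)
  qed
  have one: "cmod ((\<Sum>l\<le>q. of_real (richardson q l) * f (P S j + (h * (1/2) ^ l * z $ k) *\<^sub>R axis k 1)) - f (P S j)) \<le> B"
    if "k \<notin> S" for S j k
  proof -
    \<comment> \<open>The line is parametrised by the scale: at \<open>t = h * (1/2) ^ l\<close> it
      passes through the nodes. This puts the powers of \<open>z $ k\<close> into the
      derivatives.\<close>
    define Df where "Df i t = of_real (z $ k) ^ i * (partial_D k ^^ i) f (P S j + (t * z $ k) *\<^sub>R axis k 1)" for i t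
    \<comment> \<open>As \<open>k \<notin> S\<close>, coordinate \<open>k\<close> of
      \<open>P S j\<close> is still that of \<open>x\<close>, so moving it by at most
      \<open>h\<close> does not leave the cube.\<close>
    have mem: "\<forall>i. \<bar>(P S j + (t * z $ k) *\<^sub>R axis k 1) $ i - x $ i\<bar> \<le> h" if "0 \<le> t" "t \<le> h" for t
    proof
      have "\<bar>t * z $ k\<bar> \<le> h" using that z[of k] mult_mono[of t h "\<bar>z $ k\<bar>" 1] h by (simp add: abs_mult)
      then show "\<bar>(P S j + (t * z $ k) *\<^sub>R axis k 1) $ i - x $ i\<bar> \<le> h" for i
        using small[of "j i" i] h \<open>k \<notin> S\<close> by (auto simp: P_def axis_def)
    qed
    have "cmod ((\<Sum>l\<le>q. of_real (richardson q l) * Df 0 (h * (1/2) ^ l)) - Df 0 0) \<le> B"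
      unfolding B_def
    proof (rule richardson_error)
      fix i t assume "i < m" "0 \<le> t" "t \<le> h"
      then have "(partial_D k ^^ i) f differentiable at (P S j + (t * z $ k) *\<^sub>R axis k 1)"
        using C_infinity_differentiable[OF C_infinity_funpow_partial_D[OF f, of i k]] Q[OF mem] \<open>open \<Omega>\<close>
        by (auto simp: differentiable_on_eq_differentiable_at)
      from has_vector_derivative_along_axis[OF this]
      show "(Df i has_vector_derivative Df (Suc i) t) (at t within {0..h})"
        unfolding Df_def[abs_def] by (auto intro!: derivative_eq_intros simp: mult_ac)
    next
      fix t assume "0 \<le> t" "t \<le> h"
      then have "cmod ((partial_D k ^^ m) f (P S j + (t * z $ k) *\<^sub>R axis k 1)) \<le> M" by (intro M mem)
      moreover have "\<bar>z $ k\<bar> ^ m \<le> 1" using z[of k] by (simp add: power_le_one)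
      ultimately show "cmod (Df m t) \<le> M"
        using mult_mono[of "\<bar>z $ k\<bar> ^ m" 1] by (fastforce simp: Df_def norm_mult norm_power)
    qed (use m h in auto)
    then show ?thesis by (simp add: Df_def)
  qed
  have "cmod (E S - f x) \<le> real (card S) * ?A ^ card S * B"
    using finite[of S]
  proof (induction S rule: finite_induct)
    case empty
    have "P {} j = x" for j by (simp add: P_def vec_eq_iff)
    then show ?case by (simp add: E_def)
  next
    case (insert k S)
    have Pins: "P (insert k S) (g(k := l)) = P S g + (h * (1/2) ^ l * z $ k) *\<^sub>R axis k 1" for g l
      using insert.hyps by (auto simp: P_def vec_eq_iff axis_def)
    have inj: "inj_on (\<lambda>(y, g). g(k := y)) ({..q} \<times> PiE S (\<lambda>_. {..q}))"
      using inj_combinator[of k S "\<lambda>_. {..q}"] insert.hyps by simp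
    \<comment> \<open>An index on \<open>insert k S\<close> is an index on \<open>S\<close> with a
      value at \<open>k\<close>; summing over that value innermost isolates the one-dimensional
      sum.\<close>
    have "E (insert k S) = (\<Sum>(l, g)\<in>{..q} \<times> PiE S (\<lambda>_. {..q}).
        of_real (\<Prod>i\<in>insert k S. richardson q ((g(k := l)) i)) * f (P (insert k S) (g(k := l))))"
      unfolding E_def PiE_insert_eq by (subst sum.reindex[OF inj]) (simp add: case_prod_unfold)
    also have "\<dots> = (\<Sum>g\<in>PiE S (\<lambda>_. {..q}). \<Sum>l\<le>q.
        of_real (\<Prod>i\<in>insert k S. richardson q ((g(k := l)) i)) * f (P (insert k S) (g(k := l))))"
      by (simp add: sum.cartesian_product[symmetric] sum.swap[of _ "{..q}"])
    also have "\<dots> = (\<Sum>g\<in>PiE S (\<lambda>_. {..q}). of_real (\<Prod>i\<in>S. richardson q (g i)) *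
        (\<Sum>l\<le>q. of_real (richardson q l) * f (P S g + (h * (1/2) ^ l * z $ k) *\<^sub>R axis k 1)))"
    proof (intro sum.cong refl)
      fix g
      have "(\<Prod>i\<in>insert k S. richardson q ((g(k := l)) i)) = richardson q l * (\<Prod>i\<in>S. richardson q (g i))" for l
        using insert.hyps by (simp, intro disjI2 prod.cong) auto
      then show "(\<Sum>l\<le>q. of_real (\<Prod>i\<in>insert k S. richardson q ((g(k := l)) i)) * f (P (insert k S) (g(k := l))))
        = of_real (\<Prod>i\<in>S. richardson q (g i)) *
        (\<Sum>l\<le>q. of_real (richardson q l) * f (P S g + (h * (1/2) ^ l * z $ k) *\<^sub>R axis k 1))"
        by (simp only: Pins sum_distrib_left of_real_mult mult_ac)
    qed
    finally have "E (insert k S) - E S = (\<Sum>g\<in>PiE S (\<lambda>_. {..q}). of_real (\<Prod>i\<in>S. richardson q (g i)) *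
        ((\<Sum>l\<le>q. of_real (richardson q l) * f (P S g + (h * (1/2) ^ l * z $ k) *\<^sub>R axis k 1)) - f (P S g)))"
      by (simp add: E_def right_diff_distrib sum_subtractf)
    also have "cmod \<dots> \<le> (\<Sum>g\<in>PiE S (\<lambda>_. {..q}). \<bar>\<Prod>i\<in>S. richardson q (g i)\<bar> * B)"
      using one[OF insert.hyps(2)] by (intro sum_norm_le) (auto simp: norm_mult simp del: of_real_prod intro!: mult_left_mono)
    also have "\<dots> = ?A ^ card S * B"
      using prod_sum_PiE[of S "\<lambda>_. {..q}" "\<lambda>_ l. \<bar>richardson q l\<bar>"] insert.hyps
      by (simp add: abs_prod richardson_norm_def sum_distrib_right)
    finally have "cmod (E (insert k S) - f x) \<le> ?A ^ card S * B + real (card S) * ?A ^ card S * B"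
      using insert.IH norm_triangle_ineq[of "E (insert k S) - E S" "E S - f x"] by simp
    \<comment> \<open>The additional factor \<open>?A \<ge> 1\<close> raises the exponent to the
      cardinality of \<open>insert k S\<close>.\<close>
    also have "\<dots> = 1 * (real (Suc (card S)) * ?A ^ card S * B)" by (simp add: algebra_simps)
    also have "\<dots> \<le> ?A * (real (Suc (card S)) * ?A ^ card S * B)"
      using \<open>B \<ge> 0\<close> richardson_norm_ge_1[of q] by (intro mult_right_mono) auto
    finally show ?case using insert.hyps by (simp add: mult_ac)
  qed
  then show ?thesis by (simp add: E_def P_def B_def)
qed

text \<open>Expanding the product of the kernels gives a combination of dilated bumps. Undoing the
  dilation in each integral moves it into the argument of \<open>f\<close>, so that for fixed
  \<open>z\<close> the integrand is a Richardson sum in several variables. The vanishing moments are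
  thus used for the discrete weights only, never as integrals.\<close>

lemma mollifier_approx:
  fixes f :: "real^'n::finite \<Rightarrow> complex"
  assumes f: "f \<in> C_infinity \<Omega>" and "open \<Omega>"
    and Q: "\<And>y. (\<forall>i. \<bar>y $ i - x $ i\<bar> \<le> h) \<Longrightarrow> y \<in> \<Omega>"
    and M: "\<And>k y. (\<forall>i. \<bar>y $ i - x $ i\<bar> \<le> h) \<Longrightarrow> cmod ((partial_D k ^^ m) f y) \<le> M"
    and m: "0 < m" "m \<le> Suc q" and h: "0 < h"
  shows "integrable lborel (\<lambda>y. mollifier q h x y * f y)"
    and "cmod ((LINT y|lborel. mollifier q h x y * f y) - f x)
      \<le> real CARD('n) * richardson_norm q ^ CARD('n) * (richardson_norm q * (h ^ m * M))"
proof -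
  let ?I = "bumps_int TYPE('n)"
  let ?J = "PiE (UNIV :: 'n set) (\<lambda>_. {..q})"
  define D where "D = real CARD('n) * richardson_norm q ^ CARD('n) * (richardson_norm q * (h ^ m * M))"
  define c where "c j i = h * (1/2) ^ j i" for j and i :: 'n
  define w where "w j = (\<Prod>i\<in>UNIV. richardson q (j i))" for j :: "'n \<Rightarrow> nat"
  define P where "P j z = x + (\<chi> i. c j i * z $ i)" for j and z :: "real^'n"
  define F where "F j y = (\<Prod>i\<in>UNIV. 1 / c j i) *\<^sub>R (bumps (\<chi> i. (y $ i - x $ i) / c j i) *\<^sub>R f y)" for j y
  let ?Q = "cbox (\<chi> i. x $ i - h) (\<chi> i. x $ i + h)"
  have c: "0 < c j i" "c j i \<le> h" for j i
    using h by (auto simp: c_def power_le_one)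
  have memQ: "y \<in> ?Q \<longleftrightarrow> (\<forall>i. \<bar>y $ i - x $ i\<bar> \<le> h)" for y
    by (auto simp: mem_box_cart abs_le_iff algebra_simps)
  have contf: "continuous_on ?Q f"
    using C_infinity_continuous[OF f] Q memQ by (blast intro: continuous_on_subset)
  have Fint: "integrable lborel (F j)" for j
  proof -
    have "integrable lborel (\<lambda>y. indicator ?Q y *\<^sub>R F j y)"
      unfolding F_def using c[of j]
      by (intro borel_integrable_compact continuous_intros contf
          continuous_on_compose2[OF continuous_bumps[of UNIV]])
        (auto simp: less_imp_neq[symmetric])
    also have "(\<lambda>y. indicator ?Q y *\<^sub>R F j y) = F j"
    proof
      fix y
      have "F j y = 0" if i: "h < \<bar>y $ i - x $ i\<bar>" for i
      proof -
        have "\<bar>(y $ i - x $ i) / c j i\<bar> > 1" using i c[of j i] by (simp add: abs_divide)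
        then have "bumps (\<chi> i. (y $ i - x $ i) / c j i) = 0" by (intro bumps_eq_0[of _ i]) simp
        then show ?thesis by (simp add: F_def)
      qed
      then show "indicator ?Q y *\<^sub>R F j y = F j y"
        using memQ[of y] by (auto simp: indicator_def not_le)
    qed
    finally show ?thesis .
  qed
  have "(LINT y|lborel. F j y) = (LINT z|lborel. bumps z *\<^sub>R f (P j z))" for j
  proof -
    have [measurable]: "F j \<in> borel_measurable borel" using Fint[of j] by simp
    \<comment> \<open>The Jacobian of the substitution will cancel the normalising factors in
      \<open>F j\<close>.\<close>
    have "(LINT y|lborel. F j y) = (\<Prod>i\<in>UNIV. c j i) *\<^sub>R (LINT z|lborel. F j (P j z))"
      unfolding P_def by (rule lborel_integral_affine_cart) (auto simp: c)
    also have "(\<lambda>z. F j (P j z)) = (\<lambda>z. (\<Prod>i\<in>UNIV. 1 / c j i) *\<^sub>R (bumps z *\<^sub>R f (P j z)))"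
      using c(1)[of j] by (simp add: F_def P_def less_imp_neq[symmetric])
    finally have "(LINT y|lborel. F j y)
        = ((\<Prod>i\<in>UNIV. c j i) * (\<Prod>i\<in>UNIV. 1 / c j i)) *\<^sub>R (LINT z|lborel. bumps z *\<^sub>R f (P j z))"
      by (simp only: integral_scaleR_right scaleR_scaleR[of "\<Prod>i\<in>UNIV. c j i", symmetric])
    moreover have "(\<Prod>i\<in>UNIV. c j i) * (\<Prod>i\<in>UNIV. 1 / c j i) = 1"
      using c(1)[of j] unfolding prod.distrib[symmetric] by (simp add: less_imp_neq[symmetric])
    ultimately show ?thesis by simp
  qed
  note intF = this
  have "tens (\<lambda>i. kernel1 q h (x $ i)) y * f y = (\<Sum>j\<in>?J. w j *\<^sub>R F j y)" for y
  proof -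
    have "(\<Prod>i\<in>UNIV. kernel1 q h (x $ i) (y $ i))
        = (\<Sum>j\<in>?J. \<Prod>i\<in>UNIV. richardson q (j i) * (2 ^ j i / h) * bump ((y $ i - x $ i) * (2 ^ j i / h)))"
      unfolding kernel1_def by (subst prod_sum_PiE) auto
    also have "\<dots> = (\<Sum>j\<in>?J. w j * ((\<Prod>i\<in>UNIV. 1 / c j i) * bumps (\<chi> i. (y $ i - x $ i) / c j i)))"
      unfolding w_def bumps_def prod.distrib[symmetric]
      by (simp add: c_def power_divide mult.assoc)
    finally show ?thesis
      by (simp add: tens_def F_def scaleR_conv_of_real sum_distrib_right mult.assoc)
  qed
  note tensF = this
  have moll: "mollifier q h x y * f y = of_real (1 / ?I) * (\<Sum>j\<in>?J. w j *\<^sub>R F j y)" for y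
    by (simp only: mollifier_def mult.assoc tensF)
  show "integrable lborel (\<lambda>y. mollifier q h x y * f y)"
    unfolding moll
    by (intro integrable_mult_right Bochner_Integration.integrable_sum integrable_scaleR_right Fint)
  have contP: "continuous_on ucube (\<lambda>z. f (P j z))" for j
  proof (rule continuous_on_compose2[OF contf])
    show "continuous_on ucube (P j)" unfolding P_def by (intro continuous_intros)
    show "P j ` ucube \<subseteq> ?Q"
    proof (clarsimp simp: memQ P_def mem_ucube abs_mult)
      fix z :: "real^'n" and i assume "\<forall>i. \<bar>z $ i\<bar> \<le> 1"
      then show "\<bar>c j i\<bar> * \<bar>z $ i\<bar> \<le> h"
        using mult_mono[of "c j i" h "\<bar>z $ i\<bar>" 1] c[of j i] h by simp
    qed
  qed
  \<comment> \<open>The extrapolation error for fixed \<open>z\<close>, bounded uniformly on the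
    cube. The separated term \<open>f x\<close> is integrated against \<open>bumps\<close> alone and
    gives \<open>?I\<close> times \<open>f x\<close>.\<close>
  define g where "g z = (\<Sum>j\<in>?J. of_real (w j) * f (P j z)) - f x" for z
  have contg: "continuous_on ucube g"
    unfolding g_def by (intro continuous_intros contP)
  have g: "cmod (g z) \<le> D" if "z \<in> ucube" for z
    using richardson_telescope[OF f \<open>open \<Omega>\<close> Q M m, of x h z UNIV] that h
    by (simp add: g_def w_def P_def c_def D_def mem_ucube)
  have int: "integrable lborel (\<lambda>z. bumps z *\<^sub>R f (P j z))" for j
    by (rule bumps_times_integrable[OF contP])
  have "(LINT y|lborel. mollifier q h x y * f y)
      = of_real (1 / ?I) * (\<Sum>j\<in>?J. w j *\<^sub>R (LINT z|lborel. bumps z *\<^sub>R f (P j z)))"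
    unfolding moll integral_mult_right_zero using Fint by (simp add: intF)
  also have "(\<Sum>j\<in>?J. w j *\<^sub>R (LINT z|lborel. bumps z *\<^sub>R f (P j z)))
      = (LINT z|lborel. (\<Sum>j\<in>?J. w j *\<^sub>R (bumps z *\<^sub>R f (P j z))))"
    by (subst Bochner_Integration.integral_sum) (auto intro!: integrable_scaleR_right int simp del: scaleR_scaleR)
  also have "(\<lambda>z. \<Sum>j\<in>?J. w j *\<^sub>R (bumps z *\<^sub>R f (P j z))) = (\<lambda>z. bumps z *\<^sub>R g z + bumps z *\<^sub>R f x)"
    by (auto simp: g_def scaleR_conv_of_real right_diff_distrib sum_distrib_left mult_ac)
  also have "(LINT z|lborel. bumps z *\<^sub>R g z + bumps z *\<^sub>R f x)
      = (LINT z|lborel. bumps z *\<^sub>R g z) + ?I *\<^sub>R f x"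
    using bumps_times_integrable[OF contg] bumps_times_integrable[of "\<lambda>_. f x"]
    by (simp add: bumps_int_def bumps_integrable)
  finally have "(LINT y|lborel. mollifier q h x y * f y) - f x
      = of_real (1 / ?I) * (LINT z|lborel. bumps z *\<^sub>R g z)"
    using bumps_int_pos[where 'n = 'n] by (simp add: field_simps scaleR_conv_of_real)
  moreover have "cmod (LINT z|lborel. bumps z *\<^sub>R g z) \<le> (LINT z|lborel. bumps (z :: real^'n) * D)"
  proof (rule Bochner_Integration.integral_norm_bound_integral)
    fix z :: "real^'n"
    show "cmod (bumps z *\<^sub>R g z) \<le> bumps z * D"
    proof (cases "z \<in> ucube")
      case True
      then show ?thesis using g[OF True] by (simp add: bumps_nonneg mult_left_mono)
    next
      case False
      then obtain i where "\<bar>z $ i\<bar> > 1" by (auto simp: mem_ucube not_le)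
      then show ?thesis by (simp add: bumps_eq_0)
    qed
  qed (use bumps_integrable bumps_times_integrable[OF contg] in auto)
  then have "cmod (LINT z|lborel. bumps z *\<^sub>R g z) \<le> ?I * D"
    by (simp add: bumps_int_def)
  ultimately show "cmod ((LINT y|lborel. mollifier q h x y * f y) - f x) \<le>
      real CARD('n) * richardson_norm q ^ CARD('n) * (richardson_norm q * (h ^ m * M))"
    using bumps_int_pos[where 'n = 'n] unfolding D_def[symmetric]
    by (simp add: norm_divide pos_divide_le_eq mult.commute)
qed

subsection \<open>Negligible and moderate nets\<close>

text \<open>A uniform pointwise form of the estimates that needs no supremum: it also fits
  noncompact and empty sets, and generalized numbers become functions on the one-point set
  \<open>{()}\<close>.\<close>

definition negligible_on :: "'a set \<Rightarrow> (real \<Rightarrow> 'a \<Rightarrow> complex) \<Rightarrow> bool" where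
  "negligible_on K f \<longleftrightarrow> (\<forall>q::nat. \<exists>C. \<forall>\<^sub>F \<epsilon> in at_right 0. \<forall>x\<in>K. cmod (f \<epsilon> x) \<le> C * \<epsilon> ^ q)"

definition moderate_on :: "'a set \<Rightarrow> (real \<Rightarrow> 'a \<Rightarrow> complex) \<Rightarrow> bool" where
  "moderate_on K f \<longleftrightarrow> (\<exists>(N::nat) C. \<forall>\<^sub>F \<epsilon> in at_right 0. \<forall>x\<in>K. cmod (f \<epsilon> x) \<le> C * (1 / \<epsilon> ^ N))"

lemma eventually_index: "\<forall>\<^sub>F \<epsilon> in at_right (0::real). \<epsilon> \<in> {0<..1}"
  using eventually_at_right[of 0 "1::real"] by (auto intro!: exI[of _ 1])

lemma bigo_at_right_iff:
  assumes "\<And>\<epsilon>::real. \<epsilon> > 0 \<Longrightarrow> g \<epsilon> \<ge> (0::real)"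
  shows "f \<in> O[at_right 0](g) \<longleftrightarrow> (\<exists>C. \<forall>\<^sub>F \<epsilon> in at_right 0. \<bar>f \<epsilon>\<bar> \<le> C * g \<epsilon>)"
proof
  assume "f \<in> O[at_right 0](g)"
  then obtain C where "\<forall>\<^sub>F \<epsilon> in at_right 0. \<bar>f \<epsilon>\<bar> \<le> C * \<bar>g \<epsilon>\<bar>" by (auto simp: bigo_def)
  then have "\<forall>\<^sub>F \<epsilon> in at_right 0. \<bar>f \<epsilon>\<bar> \<le> C * g \<epsilon>"
    using eventually_index by eventually_elim (use assms in auto)
  then show "\<exists>C. \<forall>\<^sub>F \<epsilon> in at_right 0. \<bar>f \<epsilon>\<bar> \<le> C * g \<epsilon>" ..
next
  assume "\<exists>C. \<forall>\<^sub>F \<epsilon> in at_right 0. \<bar>f \<epsilon>\<bar> \<le> C * g \<epsilon>"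
  then obtain C where "\<forall>\<^sub>F \<epsilon> in at_right 0. \<bar>f \<epsilon>\<bar> \<le> C * g \<epsilon>" ..
  then have "\<forall>\<^sub>F \<epsilon> in at_right 0. norm (f \<epsilon>) \<le> C * norm (g \<epsilon>)"
    using eventually_index by eventually_elim (use assms in auto)
  then show "f \<in> O[at_right 0](g)" by (rule bigoI)
qed

lemma C_N_iff: "z \<in> C_N \<longleftrightarrow> negligible_on {()} (\<lambda>\<epsilon> _. z \<epsilon>)"
  by (simp add: C_N_def negligible_on_def bigo_at_right_iff)

lemma negligible_on_subset: "negligible_on K f \<Longrightarrow> L \<subseteq> K \<Longrightarrow> negligible_on L f"
  unfolding negligible_on_def by (fast elim: eventually_mono)

lemma negligible_on_comp:
  assumes "negligible_on K f" "\<forall>\<^sub>F \<epsilon> in at_right 0. \<forall>x\<in>L. p \<epsilon> x \<in> K"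
  shows "negligible_on L (\<lambda>\<epsilon> x. f \<epsilon> (p \<epsilon> x))"
  unfolding negligible_on_def
proof
  fix q :: nat
  obtain C where "\<forall>\<^sub>F \<epsilon> in at_right 0. \<forall>x\<in>K. cmod (f \<epsilon> x) \<le> C * \<epsilon> ^ q"
    using assms(1) unfolding negligible_on_def by blast
  with assms(2) have "\<forall>\<^sub>F \<epsilon> in at_right 0. \<forall>x\<in>L. cmod (f \<epsilon> (p \<epsilon> x)) \<le> C * \<epsilon> ^ q"
    by eventually_elim auto
  then show "\<exists>C. \<forall>\<^sub>F \<epsilon> in at_right 0. \<forall>x\<in>L. cmod (f \<epsilon> (p \<epsilon> x)) \<le> C * \<epsilon> ^ q" ..
qed

lemma negligible_on_lincomb:
  assumes "negligible_on K f" "negligible_on K g"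
    and "\<And>\<epsilon> x. \<epsilon> \<in> {0<..1} \<Longrightarrow> x \<in> K \<Longrightarrow> h \<epsilon> x = a * f \<epsilon> x + b * g \<epsilon> x"
  shows "negligible_on K h"
  unfolding negligible_on_def
proof
  fix q :: nat
  obtain C D where "\<forall>\<^sub>F \<epsilon> in at_right 0. \<forall>x\<in>K. cmod (f \<epsilon> x) \<le> C * \<epsilon> ^ q"
    "\<forall>\<^sub>F \<epsilon> in at_right 0. \<forall>x\<in>K. cmod (g \<epsilon> x) \<le> D * \<epsilon> ^ q"
    using assms(1,2) unfolding negligible_on_def by blast
  then have "\<forall>\<^sub>F \<epsilon> in at_right 0. \<forall>x\<in>K. cmod (h \<epsilon> x) \<le> (cmod a * C + cmod b * D) * \<epsilon> ^ q"
    using eventually_index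
  proof eventually_elim
    case (elim \<epsilon>)
    show ?case
    proof
      fix x assume x: "x \<in> K"
      have "cmod (h \<epsilon> x) \<le> cmod a * cmod (f \<epsilon> x) + cmod b * cmod (g \<epsilon> x)"
        using norm_triangle_ineq[of "a * f \<epsilon> x" "b * g \<epsilon> x"] elim x by (simp add: assms(3) norm_mult)
      also have "\<dots> \<le> cmod a * (C * \<epsilon> ^ q) + cmod b * (D * \<epsilon> ^ q)"
        using elim x by (intro add_mono mult_left_mono) auto
      finally show "cmod (h \<epsilon> x) \<le> (cmod a * C + cmod b * D) * \<epsilon> ^ q" by (simp add: algebra_simps)
    qed
  qed
  then show "\<exists>C. \<forall>\<^sub>F \<epsilon> in at_right 0. \<forall>x\<in>K. cmod (h \<epsilon> x) \<le> C * \<epsilon> ^ q" ..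
qed

lemma negligible_on_add: "negligible_on K f \<Longrightarrow> negligible_on K g \<Longrightarrow> negligible_on K (\<lambda>\<epsilon> x. f \<epsilon> x + g \<epsilon> x)"
  by (erule negligible_on_lincomb[where a = 1 and b = 1]) auto

lemma negligible_on_mult_moderate:
  assumes "negligible_on K f" "moderate_on K g"
  shows "negligible_on K (\<lambda>\<epsilon> x. f \<epsilon> x * g \<epsilon> x)"
  unfolding negligible_on_def
proof
  fix q :: nat
  obtain N D where "\<forall>\<^sub>F \<epsilon> in at_right 0. \<forall>x\<in>K. cmod (g \<epsilon> x) \<le> D * (1 / \<epsilon> ^ N)"
    using assms(2) unfolding moderate_on_def by blast
  \<comment> \<open>The order \<open>q + N\<close> pays for the exponent \<open>N\<close> of the
    moderate factor.\<close>
  moreover obtain C where "\<forall>\<^sub>F \<epsilon> in at_right 0. \<forall>x\<in>K. cmod (f \<epsilon> x) \<le> C * \<epsilon> ^ (q + N)"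
    using assms(1) unfolding negligible_on_def by blast
  ultimately have "\<forall>\<^sub>F \<epsilon> in at_right 0. \<forall>x\<in>K. cmod (f \<epsilon> x * g \<epsilon> x) \<le> (C * D) * \<epsilon> ^ q"
    using eventually_index
  proof eventually_elim
    case (elim \<epsilon>)
    show ?case
    proof
      fix x assume "x \<in> K"
      then have "cmod (f \<epsilon> x) * cmod (g \<epsilon> x) \<le> (C * \<epsilon> ^ (q + N)) * (D * (1 / \<epsilon> ^ N))"
        using elim order.trans[OF norm_ge_zero] by (intro mult_mono) blast+
      also have "\<dots> = (C * D) * \<epsilon> ^ q" using elim by (simp add: power_add)
      finally show "cmod (f \<epsilon> x * g \<epsilon> x) \<le> (C * D) * \<epsilon> ^ q" by (simp add: norm_mult)
    qed
  qed
  then show "\<exists>C. \<forall>\<^sub>F \<epsilon> in at_right 0. \<forall>x\<in>K. cmod (f \<epsilon> x * g \<epsilon> x) \<le> C * \<epsilon> ^ q" ..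
qed

lemma negligible_imp_moderate:
  assumes "negligible_on K f"
  shows "moderate_on K f"
proof -
  obtain C where "\<forall>\<^sub>F \<epsilon> in at_right 0. \<forall>x\<in>K. cmod (f \<epsilon> x) \<le> C * \<epsilon> ^ 0"
    using assms unfolding negligible_on_def by blast
  then show ?thesis unfolding moderate_on_def by (intro exI[of _ 0] exI[of _ C]) simp
qed

lemma negligible_on_Un:
  assumes "negligible_on K f" "negligible_on L f"
  shows "negligible_on (K \<union> L) f"
  unfolding negligible_on_def
proof
  fix q :: nat
  obtain C D where "\<forall>\<^sub>F \<epsilon> in at_right 0. \<forall>x\<in>K. cmod (f \<epsilon> x) \<le> C * \<epsilon> ^ q"
    "\<forall>\<^sub>F \<epsilon> in at_right 0. \<forall>x\<in>L. cmod (f \<epsilon> x) \<le> D * \<epsilon> ^ q"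
    using assms unfolding negligible_on_def by blast
  then have "\<forall>\<^sub>F \<epsilon> in at_right 0. \<forall>x\<in>K \<union> L. cmod (f \<epsilon> x) \<le> max C D * \<epsilon> ^ q"
    using eventually_index
  proof eventually_elim
    case (elim \<epsilon>)
    have "C * \<epsilon> ^ q \<le> max C D * \<epsilon> ^ q" "D * \<epsilon> ^ q \<le> max C D * \<epsilon> ^ q"
      using elim by (auto intro!: mult_right_mono)
    then show ?case using elim by (fastforce intro: order.trans)
  qed
  then show "\<exists>C. \<forall>\<^sub>F \<epsilon> in at_right 0. \<forall>x\<in>K \<union> L. cmod (f \<epsilon> x) \<le> C * \<epsilon> ^ q" ..
qed

text \<open>Supports are defined by open sets of vanishing. A finite subcover makes the constants of
  the local estimates uniform.\<close>

lemma negligible_on_compact_local: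
  assumes "compact K" "\<And>y. y \<in> K \<Longrightarrow> \<exists>T. open T \<and> y \<in> T \<and> negligible_on T f"
  shows "negligible_on K f"
proof -
  let ?\<T> = "{T. open T \<and> negligible_on T f}"
  have "K \<subseteq> \<Union>?\<T>" using assms(2) by auto
  then obtain \<D> where \<D>: "\<D> \<subseteq> ?\<T>" "finite \<D>" "K \<subseteq> \<Union>\<D>"
    by (rule compactE[OF assms(1)]) auto
  have "negligible_on (\<Union>\<D>) f"
    using \<D>(2,1)
  proof (induction \<D>)
    case empty
    then show ?case by (simp add: negligible_on_def)
  qed (auto intro: negligible_on_Un)
  then show ?thesis using \<D>(3) by (rule negligible_on_subset)
qed

section \<open>Classes of generalized numbers\<close>

lemma C_N_lincomb:
  "z \<in> C_N \<Longrightarrow> w \<in> C_N \<Longrightarrow> (\<And>\<epsilon>. \<epsilon> \<in> {0<..1} \<Longrightarrow> y \<epsilon> = a * z \<epsilon> + b * w \<epsilon>) \<Longrightarrow> y \<in> C_N"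
  unfolding C_N_iff by (erule (1) negligible_on_lincomb) auto

lemma C_class_eq:
  assumes "(\<lambda>\<epsilon>. z \<epsilon> - w \<epsilon>) \<in> C_N"
  shows "C_class z = C_class w"
proof -
  have mem: "y \<in> C_class z \<longleftrightarrow> (\<lambda>\<epsilon>. y \<epsilon> - z \<epsilon>) \<in> C_N" for y z
    by (auto simp: C_class_def a_r_coset_def r_coset_def C_M_ring_def intro!: bexI[of _ "\<lambda>\<epsilon>. y \<epsilon> - z \<epsilon>"])
  have "y \<in> C_class z \<longleftrightarrow> y \<in> C_class w" for y
    unfolding mem using assms
    by (auto intro: C_N_lincomb[where a = 1 and b = 1] C_N_lincomb[where a = 1 and b = "- 1"])
  then show ?thesis by blast
qed

subsection \<open>Generalized functions\<close>

lemma E_M_C_infinity: "u \<in> E_M \<Omega> \<Longrightarrow> \<epsilon> \<in> {0<..1} \<Longrightarrow> u \<epsilon> \<in> C_infinity \<Omega>"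
  by (auto simp: E_M_def)

lemma E_N_C_infinity: "u \<in> E_N \<Omega> \<Longrightarrow> \<epsilon> \<in> {0<..1} \<Longrightarrow> u \<epsilon> \<in> C_infinity \<Omega>"
  by (auto simp: E_N_def)

lemma E_M_inf_subset: "E_M_inf \<Omega> \<subseteq> E_M \<Omega>"
  by (fastforce simp: E_M_inf_def E_M_def)

lemma sup_D_bigo_iff:
  assumes u: "\<And>\<epsilon>. \<epsilon> \<in> {0<..1} \<Longrightarrow> u \<epsilon> \<in> C_infinity \<Omega>" and K: "compact K" "K \<noteq> {}" "K \<subseteq> \<Omega>"
    and g: "\<And>\<epsilon>::real. \<epsilon> > 0 \<Longrightarrow> g \<epsilon> \<ge> (0::real)"
  shows "(\<lambda>\<epsilon>. sup_D K \<alpha> (u \<epsilon>)) \<in> O[at_right 0](g)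
    \<longleftrightarrow> (\<exists>C. \<forall>\<^sub>F \<epsilon> in at_right 0. \<forall>x\<in>K. cmod (multi_D \<alpha> (u \<epsilon>) x) \<le> C * g \<epsilon>)"
proof -
  have "\<bar>sup_D K \<alpha> (u \<epsilon>)\<bar> \<le> B \<longleftrightarrow> (\<forall>x\<in>K. cmod (multi_D \<alpha> (u \<epsilon>) x) \<le> B)"
    if "\<epsilon> \<in> {0<..1}" for \<epsilon> B
  proof -
    have "\<bar>sup_D K \<alpha> (u \<epsilon>)\<bar> = sup_D K \<alpha> (u \<epsilon>)"
      using sup_D_nonneg[OF u[OF that] K(1,3,2)] by simp
    then show ?thesis
      using sup_D_upper[OF u[OF that] K(1,3)] sup_D_least[OF K(2)] by (auto intro: order.trans)
  qed
  then have "(\<forall>\<^sub>F \<epsilon> in at_right 0. \<bar>sup_D K \<alpha> (u \<epsilon>)\<bar> \<le> C * g \<epsilon>)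
      \<longleftrightarrow> (\<forall>\<^sub>F \<epsilon> in at_right 0. \<forall>x\<in>K. cmod (multi_D \<alpha> (u \<epsilon>) x) \<le> C * g \<epsilon>)" for C
    by (intro eventually_cong[OF eventually_index]) simp
  then show ?thesis by (simp add: bigo_at_right_iff[OF g])
qed

text \<open>Readmits the empty compact set, which the definitions exclude because of
  \<open>Sup\<close>; the uniform estimates are vacuous there.\<close>

lemma all_compact_iff:
  assumes "\<And>K \<alpha>. compact K \<Longrightarrow> K \<noteq> {} \<Longrightarrow> K \<subseteq> \<Omega> \<Longrightarrow> P K \<alpha> \<longleftrightarrow> Q K \<alpha>" "\<And>\<alpha>. Q {} \<alpha>"
  shows "(\<forall>K \<alpha>. compact K \<and> K \<noteq> {} \<and> K \<subseteq> \<Omega> \<longrightarrow> P K \<alpha>) \<longleftrightarrow> (\<forall>K \<alpha>. compact K \<and> K \<subseteq> \<Omega> \<longrightarrow> Q K \<alpha>)"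
proof (intro iffI allI impI)
  fix K \<alpha> assume "\<forall>K \<alpha>. compact K \<and> K \<noteq> {} \<and> K \<subseteq> \<Omega> \<longrightarrow> P K \<alpha>" "compact K \<and> K \<subseteq> \<Omega>"
  then show "Q K \<alpha>" using assms by (cases "K = {}") auto
qed (use assms in auto)

lemma E_N_iff:
  "u \<in> E_N \<Omega> \<longleftrightarrow> (\<forall>\<epsilon>\<in>{0<..1}. u \<epsilon> \<in> C_infinity \<Omega>) \<and>
    (\<forall>K \<alpha>. compact K \<and> K \<subseteq> \<Omega> \<longrightarrow> negligible_on K (\<lambda>\<epsilon>. multi_D \<alpha> (u \<epsilon>)))"
proof -
  have "(\<forall>q::nat. (\<lambda>\<epsilon>. sup_D K \<alpha> (u \<epsilon>)) \<in> O[at_right 0](\<lambda>\<epsilon>. \<epsilon> ^ q))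
      \<longleftrightarrow> negligible_on K (\<lambda>\<epsilon>. multi_D \<alpha> (u \<epsilon>))"
    if "\<forall>\<epsilon>\<in>{0<..1}. u \<epsilon> \<in> C_infinity \<Omega>" "compact K" "K \<noteq> {}" "K \<subseteq> \<Omega>" for K \<alpha>
    unfolding negligible_on_def
    by (intro all_cong1 sup_D_bigo_iff[of u \<Omega>]) (use that in auto)
  then show ?thesis
    unfolding E_N_def mem_Collect_eq
    by (intro conj_cong refl all_compact_iff) (auto simp: negligible_on_def)
qed

lemma E_M_iff:
  "u \<in> E_M \<Omega> \<longleftrightarrow> (\<forall>\<epsilon>\<in>{0<..1}. u \<epsilon> \<in> C_infinity \<Omega>) \<and>
    (\<forall>K \<alpha>. compact K \<and> K \<subseteq> \<Omega> \<longrightarrow> moderate_on K (\<lambda>\<epsilon>. multi_D \<alpha> (u \<epsilon>)))"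
proof -
  have "(\<exists>N::nat. (\<lambda>\<epsilon>. sup_D K \<alpha> (u \<epsilon>)) \<in> O[at_right 0](\<lambda>\<epsilon>. 1 / \<epsilon> ^ N))
      \<longleftrightarrow> moderate_on K (\<lambda>\<epsilon>. multi_D \<alpha> (u \<epsilon>))"
    if "\<forall>\<epsilon>\<in>{0<..1}. u \<epsilon> \<in> C_infinity \<Omega>" "compact K" "K \<noteq> {}" "K \<subseteq> \<Omega>" for K \<alpha>
    unfolding moderate_on_def
    by (intro ex_cong1 sup_D_bigo_iff[of u \<Omega>]) (use that in auto)
  then show ?thesis
    unfolding E_M_def mem_Collect_eq
    by (intro conj_cong refl all_compact_iff) (auto simp: moderate_on_def)
qed

text \<open>Here \<open>N\<close> precedes \<alpha>, but \<open>C\<close> and the range of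
  \<epsilon> may still depend on \<alpha>.\<close>

lemma E_M_inf_bound:
  assumes "u \<in> E_M_inf \<Omega>" "compact K" "K \<subseteq> \<Omega>"
  obtains N :: nat where
    "\<And>\<alpha>. \<exists>C. \<forall>\<^sub>F \<epsilon> in at_right 0. \<forall>x\<in>K. cmod (multi_D \<alpha> (u \<epsilon>) x) \<le> C * (1 / \<epsilon> ^ N)"
proof (cases "K = {}")
  case True
  then show ?thesis by (intro that[of 0]) auto
next
  case False
  then obtain N :: nat where N: "\<And>\<alpha>. (\<lambda>\<epsilon>. sup_D K \<alpha> (u \<epsilon>)) \<in> O[at_right 0](\<lambda>\<epsilon>. 1 / \<epsilon> ^ N)"
    using assms unfolding E_M_inf_def by blast
  have C: "\<And>\<epsilon>. \<epsilon> \<in> {0<..1} \<Longrightarrow> u \<epsilon> \<in> C_infinity \<Omega>" using assms(1) by (auto simp: E_M_inf_def)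
  have "\<exists>C. \<forall>\<^sub>F \<epsilon> in at_right 0. \<forall>x\<in>K. cmod (multi_D \<alpha> (u \<epsilon>) x) \<le> C * (1 / \<epsilon> ^ N)" for \<alpha>
    using N[of \<alpha>] sup_D_bigo_iff[of u \<Omega> K "\<lambda>\<epsilon>. 1 / \<epsilon> ^ N", OF C assms(2) False assms(3)] by simp
  then show ?thesis by (rule that)
qed

lemma E_N_negligible_on:
  assumes "u \<in> E_N \<Omega>" "compact K" "K \<subseteq> \<Omega>"
  shows "negligible_on K u"
proof -
  have "negligible_on K (\<lambda>\<epsilon>. multi_D (\<lambda>_. 0) (u \<epsilon>))"
    using assms unfolding E_N_iff by blast
  then show ?thesis by (simp add: multi_D_0)
qed

lemma E_M_moderate_on:
  assumes "u \<in> E_M \<Omega>" "compact K" "K \<subseteq> \<Omega>"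
  shows "moderate_on K u"
proof -
  have "moderate_on K (\<lambda>\<epsilon>. multi_D (\<lambda>_. 0) (u \<epsilon>))"
    using assms unfolding E_M_iff by blast
  then show ?thesis by (simp add: multi_D_0)
qed

lemma E_N_subset: "u \<in> E_N \<Omega> \<Longrightarrow> \<Omega>' \<subseteq> \<Omega> \<Longrightarrow> u \<in> E_N \<Omega>'"
  unfolding E_N_iff by (auto intro: C_infinity_subset)

lemma E_N_lincomb:
  assumes "open \<Omega>" "u \<in> E_N \<Omega>" "v \<in> E_N \<Omega>"
    and "\<And>\<epsilon> x. \<epsilon> \<in> {0<..1} \<Longrightarrow> x \<in> \<Omega> \<Longrightarrow> w \<epsilon> x = a * u \<epsilon> x + b * v \<epsilon> x"
  shows "w \<in> E_N \<Omega>"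
  unfolding E_N_iff
proof (intro conjI allI impI ballI)
  fix \<epsilon> :: real assume "\<epsilon> \<in> {0<..1}"
  then show "w \<epsilon> \<in> C_infinity \<Omega>"
    using assms by (intro C_infinity_lincomb[of \<Omega> "u \<epsilon>" "v \<epsilon>" "w \<epsilon>" a b]) (auto intro: E_N_C_infinity)
next
  fix K \<alpha> assume K: "compact K \<and> K \<subseteq> \<Omega>"
  show "negligible_on K (\<lambda>\<epsilon>. multi_D \<alpha> (w \<epsilon>))"
  proof (rule negligible_on_lincomb)
    show "negligible_on K (\<lambda>\<epsilon>. multi_D \<alpha> (u \<epsilon>))" "negligible_on K (\<lambda>\<epsilon>. multi_D \<alpha> (v \<epsilon>))"
      using assms(2,3) K unfolding E_N_iff by auto
    show "multi_D \<alpha> (w \<epsilon>) x = a * multi_D \<alpha> (u \<epsilon>) x + b * multi_D \<alpha> (v \<epsilon>) x"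
      if "\<epsilon> \<in> {0<..1}" "x \<in> K" for \<epsilon> x
      using that K assms by (intro multi_D_lincomb[of \<Omega>]) (auto intro: E_N_C_infinity)
  qed
qed

lemma E_N_zero_on:
  assumes "open \<Omega>" "\<And>\<epsilon>. \<epsilon> \<in> {0<..1} \<Longrightarrow> v \<epsilon> \<in> C_infinity \<Omega>"
    and "\<And>\<epsilon> x. \<epsilon> \<in> {0<..1} \<Longrightarrow> x \<in> \<Omega> \<Longrightarrow> v \<epsilon> x = 0"
  shows "v \<in> E_N \<Omega>"
proof -
  \<comment> \<open>On \<Omega> the zero function is the combination of \<open>v \<epsilon>\<close>
    with itself with coefficients \<open>0\<close>, so linearity gives its derivatives there,
    whatever the values outside.\<close>
  have zero: "multi_D \<alpha> (v \<epsilon>) x = 0 * multi_D \<alpha> (v \<epsilon>) x + 0 * multi_D \<alpha> (v \<epsilon>) x"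
    if "\<epsilon> \<in> {0<..1}" "x \<in> \<Omega>" for \<alpha> \<epsilon> x
    using that assms by (intro multi_D_lincomb[of \<Omega>]) auto
  have "\<forall>\<^sub>F \<epsilon> in at_right 0. \<forall>x\<in>K. cmod (multi_D \<alpha> (v \<epsilon>) x) \<le> 0 * \<epsilon> ^ q" if "K \<subseteq> \<Omega>" for K \<alpha> q
    using eventually_index by eventually_elim (use that zero in force)
  then show ?thesis
    using assms(2) by (auto simp: E_N_iff negligible_on_def intro!: exI[of _ 0])
qed

lemma zero_C_infinity: "open \<Omega> \<Longrightarrow> (\<lambda>x. 0) \<in> C_infinity \<Omega>"
  by (rule C_infinity_lincomb[where a = 0 and b = 0, OF _ mollifier_C_infinity mollifier_C_infinity])
    auto

lemma zero_E_N: "open \<Omega> \<Longrightarrow> (\<lambda>\<epsilon> x. 0) \<in> E_N \<Omega>"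
  by (rule E_N_zero_on) (auto intro: zero_C_infinity)

section \<open>Classes of generalized functions and their supports\<close>

lemma mem_G_class: "w \<in> G_class \<Omega> u \<longleftrightarrow> (\<exists>n\<in>E_N \<Omega>. w = (\<lambda>\<epsilon> x. n \<epsilon> x + u \<epsilon> x))"
  by (auto simp: G_class_def a_r_coset_def r_coset_def E_M_ring_def)

lemma mem_G_class_self: "open \<Omega> \<Longrightarrow> u \<in> G_class \<Omega> u"
  unfolding mem_G_class by (rule bexI[OF _ zero_E_N]) auto

lemma zero_G: "\<zero>\<^bsub>G \<Omega>\<^esub> = E_N \<Omega>"
  by (simp add: G_def FactRing_def)

lemma G_restrict_zero_imp:
  assumes "open \<Omega>'" "G_restrict \<Omega>' U = \<zero>\<^bsub>G \<Omega>'\<^esub>" "u \<in> U"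
  shows "u \<in> E_N \<Omega>'"
  using assms mem_G_class_self[OF assms(1), of u] unfolding G_restrict_def zero_G by blast

text \<open>The restriction is a union over \<open>U\<close>, so a representative \<open>u\<close>
  is needed to reach every negligible \<open>n\<close>, written as the sum of \<open>n - u\<close>
  and \<open>u\<close>.\<close>

lemma G_restrict_zero:
  assumes "open \<Omega>" "U \<noteq> {}" "U \<subseteq> E_N \<Omega>"
  shows "G_restrict \<Omega> U = \<zero>\<^bsub>G \<Omega>\<^esub>"
  unfolding zero_G
proof (intro subset_antisym subsetI)
  fix n assume "n \<in> G_restrict \<Omega> U"
  then obtain m u where *: "m \<in> E_N \<Omega>" "u \<in> E_N \<Omega>" and n: "n = (\<lambda>\<epsilon> x. m \<epsilon> x + u \<epsilon> x)"
    using assms(3) unfolding G_restrict_def mem_G_class by (auto simp: mem_G_class)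
  from E_N_lincomb[OF assms(1) *, of n 1 1] show "n \<in> E_N \<Omega>" by (simp add: n)
next
  fix n assume n: "n \<in> E_N \<Omega>"
  obtain u where u: "u \<in> U" "u \<in> E_N \<Omega>" using assms by auto
  have "(\<lambda>\<epsilon> x. n \<epsilon> x - u \<epsilon> x) \<in> E_N \<Omega>"
    by (rule E_N_lincomb[OF assms(1) n u(2), where a = 1 and b = "- 1"]) auto
  then have "n \<in> G_class \<Omega> u" unfolding mem_G_class by (rule bexI[rotated]) auto
  then show "n \<in> G_restrict \<Omega> U" using u(1) by (auto simp: G_restrict_def)
qed

text \<open>The open set \<open>\<Omega> - K\<close> is among those removed in the definition of the
  support; what remains is \<open>K\<close> minus an open set.\<close>

lemma
  assumes "open \<Omega>" "compact K" "K \<subseteq> \<Omega>" "U \<noteq> {}" "U \<subseteq> E_N (\<Omega> - K)"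
  shows G_supp_subset: "G_supp \<Omega> U \<subseteq> K" and compact_G_supp: "compact (G_supp \<Omega> U)"
proof -
  let ?\<Z> = "{\<Omega>'. open \<Omega>' \<and> \<Omega>' \<subseteq> \<Omega> \<and> G_restrict \<Omega>' U = \<zero>\<^bsub>G \<Omega>'\<^esub>}"
  have "open (\<Omega> - K)" using assms by (intro open_Diff compact_imp_closed)
  with G_restrict_zero[OF this assms(4,5)] have "\<Omega> - K \<in> ?\<Z>" by auto
  then have *: "G_supp \<Omega> U = K - \<Union>?\<Z>"
    using assms(3) unfolding G_supp_def by blast
  then show "G_supp \<Omega> U \<subseteq> K" by auto
  show "compact (G_supp \<Omega> U)"
    unfolding * using assms(2) by (intro compact_diff open_Union) auto
qed

lemma G_class_subset_E_N:
  assumes "open \<Omega>" "open \<Omega>'" "\<Omega>' \<subseteq> \<Omega>" "v \<in> E_N \<Omega>'"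
  shows "G_class \<Omega> v \<subseteq> E_N \<Omega>'"
proof
  fix w assume "w \<in> G_class \<Omega> v"
  then obtain n where n: "n \<in> E_N \<Omega>" and w: "w = (\<lambda>\<epsilon> x. n \<epsilon> x + v \<epsilon> x)" unfolding mem_G_class by blast
  from E_N_lincomb[OF assms(2) E_N_subset[OF n assms(3)] assms(4), of w 1 1]
  show "w \<in> E_N \<Omega>'" by (simp add: w)
qed

lemma G_class_in_G_c:
  assumes "open \<Omega>" "v \<in> E_M \<Omega>" "compact K" "K \<subseteq> \<Omega>" "v \<in> E_N (\<Omega> - K)"
  shows "G_class \<Omega> v \<in> G_c \<Omega>"
proof -
  have "open (\<Omega> - K)" using assms by (intro open_Diff compact_imp_closed)
  then have "G_class \<Omega> v \<subseteq> E_N (\<Omega> - K)" using assms by (intro G_class_subset_E_N) auto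
  then have "compact (G_supp \<Omega> (G_class \<Omega> v))"
    using mem_G_class_self[OF assms(1), of v] assms by (intro compact_G_supp) auto
  moreover have "G_class \<Omega> v \<in> carrier (G \<Omega>)"
    using assms(2) by (auto simp: G_def G_class_def FactRing_def A_RCOSETS_def RCOSETS_def
        a_r_coset_def E_M_ring_def)
  ultimately show ?thesis by (simp add: G_c_def)
qed

text \<open>A member of the product involves three negligible nets, one from each factor and one
  from the class of the product. Its difference from \<open>v u\<close> is
  \<open>n + n1 n2 + n1 u + n2 v\<close>, where each product is negligible times moderate.
  Continuity will give integrability on compact sets.\<close>

lemma G_mult_representative:
  assumes "open \<Omega>" "v \<in> E_M \<Omega>" "u \<in> E_M \<Omega>" "w \<in> G_class \<Omega> v \<otimes>\<^bsub>G \<Omega>\<^esub> G_class \<Omega> u"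
  shows "\<epsilon> \<in> {0<..1} \<Longrightarrow> continuous_on \<Omega> (w \<epsilon>)"
    and "compact K \<Longrightarrow> K \<subseteq> \<Omega> \<Longrightarrow> negligible_on K (\<lambda>\<epsilon> x. w \<epsilon> x - v \<epsilon> x * u \<epsilon> x)"
proof -
  obtain n n1 n2 where n: "n \<in> E_N \<Omega>" "n1 \<in> E_N \<Omega>" "n2 \<in> E_N \<Omega>"
    and w: "w = (\<lambda>\<epsilon> x. n \<epsilon> x + (n1 \<epsilon> x + v \<epsilon> x) * (n2 \<epsilon> x + u \<epsilon> x))"
    using assms(4)
    by (auto simp: G_def FactRing_def rcoset_mult_def mem_G_class a_r_coset_def r_coset_def E_M_ring_def)
  show "continuous_on \<Omega> (w \<epsilon>)" if "\<epsilon> \<in> {0<..1}"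
    unfolding w using that n assms(2,3)
    by (intro continuous_intros C_infinity_continuous) (auto intro: E_N_C_infinity E_M_C_infinity)
  assume K: "compact K" "K \<subseteq> \<Omega>"
  note neg = E_N_negligible_on[OF _ K]
  have "negligible_on K (\<lambda>\<epsilon> x. n \<epsilon> x + (n1 \<epsilon> x * n2 \<epsilon> x + (n1 \<epsilon> x * u \<epsilon> x + n2 \<epsilon> x * v \<epsilon> x)))"
    by (intro negligible_on_add negligible_on_mult_moderate neg n E_M_moderate_on[OF _ K] assms(2,3)
        negligible_imp_moderate)
  then show "negligible_on K (\<lambda>\<epsilon> x. w \<epsilon> x - v \<epsilon> x * u \<epsilon> x)"
    by (simp add: w algebra_simps)
qed

lemma G_mult_nonempty: "open \<Omega> \<Longrightarrow> G_class \<Omega> v \<otimes>\<^bsub>G \<Omega>\<^esub> G_class \<Omega> u \<noteq> {}"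
  using mem_G_class_self[of \<Omega> v] mem_G_class_self[of \<Omega> u] zero_E_N[of \<Omega>]
  by (auto simp: G_def FactRing_def rcoset_mult_def a_r_coset_def r_coset_def)

subsection \<open>The Leibniz rule\<close>

lemma partial_D_mult:
  assumes "f differentiable at x" "g differentiable at x"
  shows "partial_D i (\<lambda>x. f x * g x) x = partial_D i f x * g x + f x * partial_D i g x"
proof -
  have "((\<lambda>x. f x * g x) has_derivative
      (\<lambda>v. f x * frechet_derivative g (at x) v + frechet_derivative f (at x) v * g x)) (at x)"
    using assms by (auto simp: frechet_derivative_works intro!: has_derivative_mult)
  from frechet_derivative_at[OF this, THEN fun_cong, of "axis i 1"] this assms show ?thesis
    by (simp add: partial_D_frechet differentiableI add.commute)
qed

lemma C_infinity_mult:
  assumes "open \<Omega>" "f \<in> C_infinity \<Omega>" "g \<in> C_infinity \<Omega>"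
  shows "(\<lambda>x. f x * g x) \<in> C_infinity \<Omega>"
proof -
  have "C_k k \<Omega> (\<lambda>x. f x * g x)" for k
    using assms(2,3)
  proof (induction k arbitrary: f g)
    case 0
    then show ?case unfolding C_k.simps by (intro continuous_on_mult C_infinity_continuous)
  next
    case (Suc k)
    have d: "f differentiable at x" "g differentiable at x" if "x \<in> \<Omega>" for x
      using Suc.prems[THEN C_infinity_differentiable] that assms(1)
      by (auto simp: differentiable_on_eq_differentiable_at)
    have "C_k k \<Omega> (partial_D i (\<lambda>x. f x * g x))" for i
    proof (rule C_k_lincomb[OF assms(1)])
      show "C_k k \<Omega> (\<lambda>x. partial_D i f x * g x)" "C_k k \<Omega> (\<lambda>x. f x * partial_D i g x)"
        using Suc.prems by (auto intro!: Suc.IH C_infinity_partial_D)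
      show "partial_D i (\<lambda>x. f x * g x) x = 1 * (partial_D i f x * g x) + 1 * (f x * partial_D i g x)"
        if "x \<in> \<Omega>" for x
        using partial_D_mult[OF d[OF that]] by simp
    qed
    then show ?case
      using d assms(1) by (auto simp: differentiable_on_eq_differentiable_at intro!: differentiable_mult)
  qed
  then show ?thesis by (simp add: C_infinity_def)
qed

lemma partial_D_sum_list:
  assumes "open \<Omega>" "\<And>p. p \<in> set ps \<Longrightarrow> F p \<in> C_infinity \<Omega>" "x \<in> \<Omega>"
  shows "partial_D i (\<lambda>x. \<Sum>p\<leftarrow>ps. F p x) x = (\<Sum>p\<leftarrow>ps. partial_D i (F p) x)"
    and "(\<lambda>x. \<Sum>p\<leftarrow>ps. F p x) \<in> C_infinity \<Omega>"
proof -
  have "(\<lambda>x. \<Sum>p\<leftarrow>ps. F p x) \<in> C_infinity \<Omega> \<and>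
      (\<forall>x\<in>\<Omega>. partial_D i (\<lambda>x. \<Sum>p\<leftarrow>ps. F p x) x = (\<Sum>p\<leftarrow>ps. partial_D i (F p) x))"
    using assms(2)
  proof (induction ps)
    case Nil
    have "partial_D i (\<lambda>x. 0) x = 0" for x :: "real^'a" by (simp add: partial_D_def)
    then show ?case using zero_C_infinity[OF assms(1)] by simp
  next
    case (Cons p ps)
    then have *: "F p \<in> C_infinity \<Omega>" "(\<lambda>x. \<Sum>p\<leftarrow>ps. F p x) \<in> C_infinity \<Omega>" by auto
    show ?case
      using Cons C_infinity_lincomb[OF assms(1) *, of "\<lambda>x. \<Sum>p\<leftarrow>p # ps. F p x" 1 1]
        partial_D_lincomb(2)[OF assms(1) *[THEN C_infinity_differentiable], of "\<lambda>x. \<Sum>p\<leftarrow>p # ps. F p x" 1 1]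
      by simp
  qed
  then show "partial_D i (\<lambda>x. \<Sum>p\<leftarrow>ps. F p x) x = (\<Sum>p\<leftarrow>ps. partial_D i (F p) x)"
    "(\<lambda>x. \<Sum>p\<leftarrow>ps. F p x) \<in> C_infinity \<Omega>" using assms(3) by auto
qed

text \<open>A weak form of the Leibniz rule that suffices for estimates; since each coordinate is
  differentiated when it is at the head of the list, the partial derivatives need not commute.\<close>

lemma multi_D_mult:
  fixes \<Omega> :: "(real^'n::finite) set"
  assumes "open \<Omega>"
  shows "\<exists>ps. \<forall>f\<in>C_infinity \<Omega>. \<forall>g\<in>C_infinity \<Omega>. \<forall>x\<in>\<Omega>.
    multi_D \<alpha> (\<lambda>x. f x * g x) x = (\<Sum>(\<beta>, \<gamma>)\<leftarrow>ps. multi_D \<beta> f x * multi_D \<gamma> g x)"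
proof -
  define D where "D \<alpha> is = foldr (\<lambda>i. partial_D i ^^ \<alpha> i) is" for \<alpha> :: "'n \<Rightarrow> nat" and "is"
  have D_C: "D \<alpha> is f \<in> C_infinity \<Omega>" if "f \<in> C_infinity \<Omega>" for \<alpha> "is" f
    unfolding D_def by (rule C_infinity_foldr[OF that])
  have D_cong: "D \<alpha> is = D \<beta> is" if "\<And>i. i \<in> set is \<Longrightarrow> \<alpha> i = \<beta> i" for \<alpha> \<beta> "is"
    unfolding D_def using that by (intro ext foldr_cong) auto
  have D_Cons: "D \<alpha> (i # is) f = (partial_D i ^^ \<alpha> i) (D \<alpha> is f)" for \<alpha> i "is" f
    by (simp add: D_def)
  define L where "L T is \<longleftrightarrow> (\<exists>ps. \<forall>f\<in>C_infinity \<Omega>. \<forall>g\<in>C_infinity \<Omega>.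
      T (\<lambda>x. f x * g x) \<in> C_infinity \<Omega> \<and>
      (\<forall>x\<in>\<Omega>. T (\<lambda>x. f x * g x) x = (\<Sum>(\<beta>, \<gamma>)\<leftarrow>ps. D \<beta> is f x * D \<gamma> is g x)))" for T "is"
  \<comment> \<open>One more derivative in the head coordinate raises the exponent of
    \<open>i\<close> in one of the two factors. The result is again of the form \<open>D\<close>,
    since \<open>i\<close> does not occur in the tail and the change is invisible there.\<close>
  have step: "L (partial_D i \<circ> T) (i # is)" if "L T (i # is)" "i \<notin> set is" for T i "is"
  proof -
    from that(1) obtain ps where "\<forall>f\<in>C_infinity \<Omega>. \<forall>g\<in>C_infinity \<Omega>.
        T (\<lambda>x. f x * g x) \<in> C_infinity \<Omega> \<and> (\<forall>x\<in>\<Omega>.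
        T (\<lambda>x. f x * g x) x = (\<Sum>(\<beta>, \<gamma>)\<leftarrow>ps. D \<beta> (i # is) f x * D \<gamma> (i # is) g x))"
      unfolding L_def by (elim exE)
    then have ps: "\<And>f g. f \<in> C_infinity \<Omega> \<Longrightarrow> g \<in> C_infinity \<Omega> \<Longrightarrow> T (\<lambda>x. f x * g x) \<in> C_infinity \<Omega>"
      "\<And>f g x. f \<in> C_infinity \<Omega> \<Longrightarrow> g \<in> C_infinity \<Omega> \<Longrightarrow> x \<in> \<Omega> \<Longrightarrow>
        T (\<lambda>x. f x * g x) x = (\<Sum>(\<beta>, \<gamma>)\<leftarrow>ps. D \<beta> (i # is) f x * D \<gamma> (i # is) g x)"
      by simp_all
    let ?s = "\<lambda>\<beta>. \<beta>(i := Suc (\<beta> i))"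
    have s: "partial_D i (D \<beta> (i # is) f) = D (?s \<beta>) (i # is) f" for \<beta> f
    proof -
      have "D \<beta> is = D (?s \<beta>) is" using that(2) by (intro D_cong) auto
      then show ?thesis by (simp add: D_Cons)
    qed
    let ?qs = "concat (map (\<lambda>(\<beta>, \<gamma>). [(?s \<beta>, \<gamma>), (\<beta>, ?s \<gamma>)]) ps)"
    have "partial_D i (T (\<lambda>x. f x * g x)) x = (\<Sum>(\<beta>, \<gamma>)\<leftarrow>?qs. D \<beta> (i # is) f x * D \<gamma> (i # is) g x)"
      if fg: "f \<in> C_infinity \<Omega>" "g \<in> C_infinity \<Omega>" "x \<in> \<Omega>" for f g x
    proof -
      define F where "F p x = D (fst p) (i # is) f x * D (snd p) (i # is) g x" for p x
      have F: "F p \<in> C_infinity \<Omega>" for p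
        unfolding F_def[abs_def] by (intro C_infinity_mult assms D_C fg)
      have pd: "partial_D i (F p) x = D (?s (fst p)) (i # is) f x * D (snd p) (i # is) g x
          + D (fst p) (i # is) f x * D (?s (snd p)) (i # is) g x" for p
        unfolding F_def[abs_def] s[symmetric]
        using D_C[OF fg(1), THEN C_infinity_differentiable] D_C[OF fg(2), THEN C_infinity_differentiable] assms fg(3)
        by (intro partial_D_mult) (auto simp: differentiable_on_eq_differentiable_at)
      \<comment> \<open>The expansion of \<open>T\<close> holds on \<Omega> only, so it is
        differentiated through the local combination with coefficients \<open>1\<close> and
        \<open>0\<close>.\<close>
      have "partial_D i (T (\<lambda>x. f x * g x)) x
          = 1 * partial_D i (\<lambda>x. \<Sum>p\<leftarrow>ps. F p x) x + 0 * partial_D i (\<lambda>x. \<Sum>p\<leftarrow>ps. F p x) x"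
      proof -
        have "(\<lambda>x. \<Sum>p\<leftarrow>ps. F p x) differentiable_on \<Omega>"
          by (intro C_infinity_differentiable partial_D_sum_list(2)[OF assms F fg(3)])
        then show ?thesis
          using ps(2)[OF fg(1,2)] fg(3)
          by (intro partial_D_lincomb(2)[OF assms]) (simp_all add: F_def case_prod_unfold)
      qed
      also have "\<dots> = (\<Sum>p\<leftarrow>ps. partial_D i (F p) x)"
        using partial_D_sum_list(1)[OF assms F fg(3)] by simp
      also have "\<dots> = (\<Sum>(\<beta>, \<gamma>)\<leftarrow>?qs. D \<beta> (i # is) f x * D \<gamma> (i # is) g x)"
        unfolding pd by (induction ps) (auto simp: case_prod_unfold)
      finally show ?thesis .
    qed
    then show ?thesis
      unfolding L_def using ps(1) by (intro exI[of _ ?qs]) (simp add: o_def C_infinity_partial_D)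
  qed
  have "distinct is \<Longrightarrow> L (D \<alpha> is) is" for "is"
  proof (induction "is")
    case Nil
    show ?case
      unfolding L_def by (rule exI[of _ "[(\<lambda>_. 0, \<lambda>_. 0)]"]) (simp add: D_def C_infinity_mult assms)
  next
    case (Cons i "is")
    then have "L (D \<alpha> is) is" by simp
    then obtain ps where ps: "\<forall>f\<in>C_infinity \<Omega>. \<forall>g\<in>C_infinity \<Omega>. D \<alpha> is (\<lambda>x. f x * g x) \<in> C_infinity \<Omega> \<and>
      (\<forall>x\<in>\<Omega>. D \<alpha> is (\<lambda>x. f x * g x) x = (\<Sum>(\<beta>, \<gamma>)\<leftarrow>ps. D \<beta> is f x * D \<gamma> is g x))"
      unfolding L_def by (elim exE)
    have 0: "D (\<beta>(i := 0)) (i # is) = D \<beta> is" for \<beta>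
    proof -
      have "D (\<beta>(i := 0)) is = D \<beta> is" using Cons.prems by (intro D_cong) auto
      then show ?thesis by (intro ext) (simp add: D_Cons)
    qed
    \<comment> \<open>Before any derivative in direction \<open>i\<close> is taken, its exponent
      must count as \<open>0\<close> in both factors, whatever the indices found for the tail
      contain at \<open>i\<close>.\<close>
    have "L (D \<alpha> is) (i # is)"
      unfolding L_def using ps
      by (intro exI[of _ "map (\<lambda>(\<beta>, \<gamma>). (\<beta>(i := 0), \<gamma>(i := 0))) ps"])
        (simp add: case_prod_unfold o_def 0)
    then have "L ((partial_D i ^^ k) \<circ> D \<alpha> is) (i # is)" for k
      by (induction k) (use step Cons.prems in \<open>auto simp: o_assoc[symmetric]\<close>)
    moreover have "(partial_D i ^^ \<alpha> i) \<circ> D \<alpha> is = D \<alpha> (i # is)" by (intro ext) (simp add: D_Cons)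
    ultimately show ?case by metis
  qed
  from this[OF coords(1)] show ?thesis unfolding L_def D_def multi_D_def by blast
qed

text \<open>Serves to locate the support of a product. Membership in \<open>E_N\<close> concerns all
  derivatives, whence the Leibniz rule; each of its terms is negligible times moderate.\<close>

lemma E_N_mult:
  assumes "open \<Omega>" "u \<in> E_N \<Omega>" "v \<in> E_M \<Omega>"
  shows "(\<lambda>\<epsilon> x. u \<epsilon> x * v \<epsilon> x) \<in> E_N \<Omega>"
  unfolding E_N_iff
proof (intro conjI ballI allI impI)
  fix \<epsilon> :: real assume "\<epsilon> \<in> {0<..1}"
  then show "(\<lambda>x. u \<epsilon> x * v \<epsilon> x) \<in> C_infinity \<Omega>"
    using assms by (intro C_infinity_mult E_N_C_infinity E_M_C_infinity)
next
  fix K \<alpha> assume K: "compact K \<and> K \<subseteq> \<Omega>"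
  obtain ps where ps: "\<forall>f\<in>C_infinity \<Omega>. \<forall>g\<in>C_infinity \<Omega>. \<forall>x\<in>\<Omega>.
      multi_D \<alpha> (\<lambda>x. f x * g x) x = (\<Sum>(\<beta>, \<gamma>)\<leftarrow>ps. multi_D \<beta> f x * multi_D \<gamma> g x)"
    using multi_D_mult[OF assms(1)] by blast
  have neg: "negligible_on K (\<lambda>\<epsilon> x. multi_D \<beta> (u \<epsilon>) x * multi_D \<gamma> (v \<epsilon>) x)" for \<beta> \<gamma>
    using assms(2,3) K unfolding E_N_iff E_M_iff by (intro negligible_on_mult_moderate) auto
  have 1: "negligible_on K (\<lambda>\<epsilon> x. \<Sum>(\<beta>, \<gamma>)\<leftarrow>ps. multi_D \<beta> (u \<epsilon>) x * multi_D \<gamma> (v \<epsilon>) x)"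
  proof (induction ps)
    case Nil
    show ?case by (auto simp: negligible_on_def intro!: exI[of _ 0])
  next
    case (Cons p ps)
    then show ?case
      using negligible_on_add[OF neg Cons] by (simp add: case_prod_unfold)
  qed
  show "negligible_on K (\<lambda>\<epsilon>. multi_D \<alpha> (\<lambda>x. u \<epsilon> x * v \<epsilon> x))"
    by (rule negligible_on_lincomb[where a = 1 and b = 0, OF 1 1])
      (use ps K assms(2,3) E_N_C_infinity E_M_C_infinity in fastforce)
qed

subsection \<open>Products and supports\<close>

lemma E_M_subset: "u \<in> E_M \<Omega> \<Longrightarrow> \<Omega>' \<subseteq> \<Omega> \<Longrightarrow> u \<in> E_M \<Omega>'"
  unfolding E_M_iff by (auto intro: C_infinity_subset)

lemma E_N_imp_E_M: "u \<in> E_N \<Omega> \<Longrightarrow> u \<in> E_M \<Omega>"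
  unfolding E_M_iff E_N_iff by (auto intro: negligible_imp_moderate)

lemma G_mult_subset_E_N:
  assumes "open \<Omega>" "open \<Omega>'" "\<Omega>' \<subseteq> \<Omega>" "v \<in> E_N \<Omega>'" "u \<in> E_M \<Omega>"
  shows "G_class \<Omega> v \<otimes>\<^bsub>G \<Omega>\<^esub> G_class \<Omega> u \<subseteq> E_N \<Omega>'"
proof
  fix w assume "w \<in> G_class \<Omega> v \<otimes>\<^bsub>G \<Omega>\<^esub> G_class \<Omega> u"
  then obtain n a m where n: "n \<in> E_N \<Omega>" and a: "a \<in> G_class \<Omega> v" and m: "m \<in> E_N \<Omega>"
    and w: "w = (\<lambda>\<epsilon> x. n \<epsilon> x + a \<epsilon> x * (m \<epsilon> x + u \<epsilon> x))"
    by (auto simp: G_def FactRing_def rcoset_mult_def mem_G_class[of _ _ u] a_r_coset_def r_coset_def E_M_ring_def)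
  have a: "a \<in> E_N \<Omega>'" using G_class_subset_E_N[OF assms(1-4)] a by blast
  note n = E_N_subset[OF n assms(3)] and m = E_N_subset[OF m assms(3), THEN E_N_imp_E_M]
    and u = E_M_subset[OF assms(5,3)]
  have "(\<lambda>\<epsilon> x. a \<epsilon> x * (m \<epsilon> x + u \<epsilon> x)) \<in> E_N \<Omega>'"
    by (rule E_N_lincomb[OF assms(2) E_N_mult[OF assms(2) a m] E_N_mult[OF assms(2) a u], where a = 1 and b = 1])
      (simp add: distrib_left)
  from E_N_lincomb[OF assms(2) n this, of w 1 1] show "w \<in> E_N \<Omega>'" by (simp add: w)
qed

subsection \<open>The representing net\<close>

lemma eventually_le_inverse: "\<forall>\<^sub>F \<epsilon> in at_right (0::real). B \<le> 1 / \<epsilon>"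
  using filterlim_inverse_at_top_right unfolding filterlim_at_top by (simp add: inverse_eq_divide)

text \<open>\<open>q \<epsilon>\<close> is the largest \<open>k\<close> such that \<open>k\<close>
  and \<open>b k\<close> are at most \<open>1 / \<epsilon>\<close>. The bound on \<open>k\<close>
  makes the set finite, and every fixed \<open>m\<close> belongs to it for small \<epsilon>;
  \<open>m = 0\<close> shows that the maximum is attained.\<close>

lemma slow_index_exists:
  fixes b :: "nat \<Rightarrow> real"
  obtains q :: "real \<Rightarrow> nat" where "\<forall>\<^sub>F \<epsilon> in at_right 0. b (q \<epsilon>) \<le> 1 / \<epsilon>" "\<And>m. \<forall>\<^sub>F \<epsilon> in at_right 0. m \<le> q \<epsilon>"
proof -
  define S where "S \<epsilon> = {k. real k \<le> 1 / \<epsilon> \<and> b k \<le> 1 / \<epsilon>}" for \<epsilon> :: real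
  have fin: "finite (S \<epsilon>)" for \<epsilon>
    by (rule finite_subset[of _ "{..nat \<lceil>1 / \<epsilon>\<rceil>}"]) (auto simp: S_def le_nat_iff, linarith)
  have S: "\<forall>\<^sub>F \<epsilon> in at_right 0. m \<in> S \<epsilon>" for m
    using eventually_le_inverse[of "real m"] eventually_le_inverse[of "b m"]
    by eventually_elim (simp add: S_def)
  show ?thesis
  proof
    show "\<forall>\<^sub>F \<epsilon> in at_right 0. b (Max (S \<epsilon>)) \<le> 1 / \<epsilon>"
      using S[of 0]
    proof eventually_elim
      case (elim \<epsilon>)
      then have "Max (S \<epsilon>) \<in> S \<epsilon>" using Max_in[OF fin[of \<epsilon>]] by blast
      then show ?case by (simp add: S_def)
    qed
    show "\<forall>\<^sub>F \<epsilon> in at_right 0. m \<le> Max (S \<epsilon>)" for m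
      using S[of m] by eventually_elim (rule Max_ge[OF fin])
  qed
qed

text \<open>The value \<open>0\<close> where \<open>x \<epsilon>\<close> is not in \<open>K\<close>,
  and the factor \<delta> in the scale, keep the supports in one compact set for all indices in
  \<open>{0<..1}\<close>, not just for small ones.\<close>

definition point_net ::
    "(real \<Rightarrow> nat) \<Rightarrow> real \<Rightarrow> (real^'n::finite) set \<Rightarrow> 'n pnet \<Rightarrow> 'n fnet" where
  "point_net q \<delta> K x \<epsilon> = (if x \<epsilon> \<in> K then mollifier (q \<epsilon>) (\<delta> * \<epsilon>) (x \<epsilon>) else (\<lambda>_. 0))"

lemma point_net_E_M:
  fixes \<Omega> :: "(real^'n::finite) set"
  assumes "open \<Omega>" "0 < \<delta>" "\<delta> \<le> 1"
    and A: "\<forall>\<^sub>F \<epsilon> in at_right 0. richardson_norm (q \<epsilon>) \<le> 1 / \<epsilon>"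
    and q2: "\<forall>\<^sub>F \<epsilon> in at_right 0. 2 ^ q \<epsilon> \<le> 1 / \<epsilon>"
  shows "point_net q \<delta> K x \<in> E_M \<Omega>"
  unfolding E_M_iff
proof (intro conjI ballI allI impI)
  show "point_net q \<delta> K x \<epsilon> \<in> C_infinity \<Omega>" for \<epsilon>
    using assms(1) by (simp add: point_net_def mollifier_C_infinity zero_C_infinity)
next
  fix L and \<alpha> :: "'n \<Rightarrow> nat" assume "compact L \<and> L \<subseteq> \<Omega>"
  let ?I = "bumps_int TYPE('n)"
  have "\<exists>M. M \<ge> 0 \<and> (\<forall>t. \<bar>(deriv ^^ a) bump t\<bar> \<le> M)" for a
    using higher_deriv_bump_bounded[of a] by metis
  then obtain M where M: "\<And>a. M a \<ge> 0" "\<And>a t. \<bar>(deriv ^^ a) bump t\<bar> \<le> M a" by metis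
  \<comment> \<open>In coordinate \<open>i\<close> the weights cost one power of
    \<open>1 / \<epsilon>\<close>, and each of the \<open>Suc (\<alpha> i)\<close> factors
    \<open>2 ^ q \<epsilon> / (\<delta> * \<epsilon>)\<close> costs two.\<close>
  define N where "N = (\<Sum>i\<in>UNIV. 1 + 2 * Suc (\<alpha> i))"
  define C where "C = 1 / ?I * (\<Prod>i\<in>UNIV. M (\<alpha> i) / \<delta> ^ Suc (\<alpha> i))"
  have I: "?I > 0" by (rule bumps_int_pos)
  have C: "C \<ge> 0" unfolding C_def using I M(1) assms(2) by (intro mult_nonneg_nonneg prod_nonneg) auto
  have "\<forall>\<^sub>F \<epsilon> in at_right 0. \<forall>y\<in>L. cmod (multi_D \<alpha> (point_net q \<delta> K x \<epsilon>) y) \<le> C * (1 / \<epsilon> ^ N)"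
    using A q2 eventually_index
  proof (eventually_elim, intro ballI)
    fix \<epsilon> y assume A: "richardson_norm (q \<epsilon>) \<le> 1 / \<epsilon>" and q2: "2 ^ q \<epsilon> \<le> 1 / \<epsilon>" and \<epsilon>: "\<epsilon> \<in> {0<..1}"
    let ?h = "\<delta> * \<epsilon>"
    have h: "0 < ?h" "?h \<le> 1" using \<epsilon> assms(2,3) by (auto intro: mult_le_one)
    show "cmod (multi_D \<alpha> (point_net q \<delta> K x \<epsilon>) y) \<le> C * (1 / \<epsilon> ^ N)"
    proof (cases "x \<epsilon> \<in> K")
      case True
      have "\<bar>(deriv ^^ \<alpha> i) (kernel1 (q \<epsilon>) ?h (x \<epsilon> $ i)) (y $ i)\<bar>
          \<le> M (\<alpha> i) / \<delta> ^ Suc (\<alpha> i) * (1 / \<epsilon> ^ (1 + 2 * Suc (\<alpha> i)))" for i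
      proof -
        have "\<bar>(deriv ^^ \<alpha> i) (kernel1 (q \<epsilon>) ?h (x \<epsilon> $ i)) (y $ i)\<bar>
            \<le> richardson_norm (q \<epsilon>) * (2 ^ q \<epsilon> / ?h) ^ Suc (\<alpha> i) * M (\<alpha> i)"
          by (rule kernel1_higher_deriv_bound[OF h M(2)])
        also have "\<dots> \<le> 1 / \<epsilon> * (1 / \<epsilon> / ?h) ^ Suc (\<alpha> i) * M (\<alpha> i)"
          using A q2 h \<epsilon> M(1) richardson_norm_ge_1[of "q \<epsilon>"]
          by (intro mult_right_mono mult_mono power_mono divide_right_mono) auto
        also have "\<dots> = M (\<alpha> i) / \<delta> ^ Suc (\<alpha> i) * (1 / \<epsilon> ^ (1 + 2 * Suc (\<alpha> i)))"
          using \<epsilon> assms(2)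
          by (simp only: power_add power_mult power_divide power_mult_distrib power_one power_one_right
              power2_eq_square) (simp add: field_simps)
        finally show ?thesis .
      qed
      then have "(\<Prod>i\<in>UNIV. \<bar>(deriv ^^ \<alpha> i) (kernel1 (q \<epsilon>) ?h (x \<epsilon> $ i)) (y $ i)\<bar>)
          \<le> (\<Prod>i\<in>UNIV. M (\<alpha> i) / \<delta> ^ Suc (\<alpha> i) * (1 / \<epsilon> ^ (1 + 2 * Suc (\<alpha> i))))"
        by (intro prod_mono) auto
      also have "\<dots> = (\<Prod>i\<in>UNIV. M (\<alpha> i) / \<delta> ^ Suc (\<alpha> i)) * (1 / \<epsilon> ^ N)"
        unfolding prod.distrib N_def power_sum prod_dividef by simp
      finally have "1 / ?I * (\<Prod>i\<in>UNIV. \<bar>(deriv ^^ \<alpha> i) (kernel1 (q \<epsilon>) ?h (x \<epsilon> $ i)) (y $ i)\<bar>)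
          \<le> 1 / ?I * ((\<Prod>i\<in>UNIV. M (\<alpha> i) / \<delta> ^ Suc (\<alpha> i)) * (1 / \<epsilon> ^ N))"
        using I by (intro mult_left_mono) auto
      then show ?thesis
        using True I
        by (simp only: point_net_def if_True multi_D_mollifier tens_def norm_mult norm_of_real abs_prod C_def)
           (simp add: mult.assoc)
    next
      case False
      have "multi_D \<alpha> (\<lambda>_::real^'n. 0) y = 0 * multi_D \<alpha> (\<lambda>_. 0) y + 0 * multi_D \<alpha> (\<lambda>_. 0) y"
        by (rule multi_D_lincomb[of UNIV]) (auto intro: zero_C_infinity)
      then show ?thesis using False C \<epsilon> by (simp add: point_net_def)
    qed
  qed
  then show "moderate_on L (\<lambda>\<epsilon>. multi_D \<alpha> (point_net q \<delta> K x \<epsilon>))"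
    unfolding moderate_on_def by blast
qed

lemma point_net_eq_0:
  assumes "\<And>p y. p \<in> K \<Longrightarrow> (\<forall>i. \<bar>y $ i - p $ i\<bar> \<le> \<delta>) \<Longrightarrow> y \<in> L" "0 < \<delta>" "\<epsilon> \<in> {0<..1}" "y \<notin> L"
  shows "point_net q \<delta> K x \<epsilon> y = 0"
proof (cases "x \<epsilon> \<in> K")
  case True
  then obtain i where "\<bar>y $ i - x \<epsilon> $ i\<bar> > \<delta>" using assms(1,4) by (meson not_le)
  moreover have "\<delta> * \<epsilon> \<le> \<delta>" using assms(2,3) by (simp add: mult_left_le)
  ultimately have "\<delta> * \<epsilon> < \<bar>y $ i - x \<epsilon> $ i\<bar>" by linarith
  then have "mollifier (q \<epsilon>) (\<delta> * \<epsilon>) (x \<epsilon>) y = 0"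
    using assms(2,3) by (intro mollifier_eq_0[of _ _ i]) auto
  then show ?thesis using True by (simp add: point_net_def)
qed (simp add: point_net_def)

lemma point_net_approx:
  fixes \<Omega> :: "(real^'n::finite) set"
  assumes "open \<Omega>" "0 < \<delta>" "\<delta> \<le> 1" and L: "compact L" "L \<subseteq> \<Omega>"
    and box: "\<And>p y. p \<in> K \<Longrightarrow> (\<forall>i. \<bar>y $ i - p $ i\<bar> \<le> \<delta>) \<Longrightarrow> y \<in> L"
    and x: "\<forall>\<^sub>F \<epsilon> in at_right 0. x \<epsilon> \<in> K"
    and A: "\<forall>\<^sub>F \<epsilon> in at_right 0. richardson_norm (q \<epsilon>) \<le> 1 / \<epsilon>"
    and q: "\<And>m. \<forall>\<^sub>F \<epsilon> in at_right 0. m \<le> q \<epsilon>"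
    and u: "u \<in> E_M_inf \<Omega>"
  shows "(\<lambda>\<epsilon>. (LINT y|lborel. point_net q \<delta> K x \<epsilon> y * u \<epsilon> y) - u \<epsilon> (x \<epsilon>)) \<in> C_N"
  unfolding C_N_iff negligible_on_def
proof
  fix r :: nat
  let ?n = "CARD('n)"
  obtain N :: nat where N: "\<And>\<alpha>. \<exists>C. \<forall>\<^sub>F \<epsilon> in at_right 0. \<forall>y\<in>L. cmod (multi_D \<alpha> (u \<epsilon>) y) \<le> C * (1 / \<epsilon> ^ N)"
    using E_M_inf_bound[OF u L] by blast
  \<comment> \<open>The error contains \<open>?n + 1\<close> factors
    \<open>richardson_norm (q \<epsilon>) \<le> 1 / \<epsilon>\<close> and the bound
    \<open>1 / \<epsilon> ^ N\<close> on the derivatives; after paying for these,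
    \<open>\<epsilon> ^ m\<close> leaves \<open>\<epsilon> ^ r\<close>.\<close>
  define m where "m = N + ?n + 1 + r"
  have "\<exists>C. \<forall>\<^sub>F \<epsilon> in at_right 0. \<forall>y\<in>L. cmod ((partial_D k ^^ m) (u \<epsilon>) y) \<le> C * (1 / \<epsilon> ^ N)" for k
    using N[of "\<lambda>i. if i = k then m else 0"] by (simp only: multi_D_single)
  from choice[OF allI[OF this]] obtain C where
    C: "\<forall>k. \<forall>\<^sub>F \<epsilon> in at_right 0. \<forall>y\<in>L. cmod ((partial_D k ^^ m) (u \<epsilon>) y) \<le> C k * (1 / \<epsilon> ^ N)" ..
  define B where "B = (\<Sum>k\<in>UNIV. \<bar>C k\<bar>)"
  have CB: "C k \<le> B" for k
    using member_le_sum[of k UNIV "\<lambda>k. \<bar>C k\<bar>"] by (simp add: B_def)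
  have "\<forall>\<^sub>F \<epsilon> in at_right 0. \<forall>k. \<forall>y\<in>L. cmod ((partial_D k ^^ m) (u \<epsilon>) y) \<le> C k * (1 / \<epsilon> ^ N)"
    by (rule eventually_all_finite[OF C[rule_format]])
  then have "\<forall>\<^sub>F \<epsilon> in at_right 0. cmod ((LINT y|lborel. point_net q \<delta> K x \<epsilon> y * u \<epsilon> y) - u \<epsilon> (x \<epsilon>))
      \<le> (real ?n * B) * \<epsilon> ^ r"
    using x A q[of m] eventually_index
  proof eventually_elim
    case (elim \<epsilon>)
    note M = elim(1) and xK = elim(2) and A = elim(3) and mq = elim(4) and \<epsilon> = elim(5)
    let ?h = "\<delta> * \<epsilon>" and ?M = "B * (1 / \<epsilon> ^ N)" and ?A = "richardson_norm (q \<epsilon>)"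
    have h: "0 < ?h" "?h \<le> \<delta>" "?h \<le> \<epsilon>" using assms(2,3) \<epsilon> by (auto simp: mult_left_le mult_left_le_one_le)
    have mem: "y \<in> L" if "\<forall>i. \<bar>y $ i - x \<epsilon> $ i\<bar> \<le> ?h" for y
      using box[OF xK, of y] that h(2) by (meson order.trans)
    have B0: "B \<ge> 0" by (simp add: B_def sum_nonneg)
    have "cmod ((LINT y|lborel. mollifier (q \<epsilon>) ?h (x \<epsilon>) y * u \<epsilon> y) - u \<epsilon> (x \<epsilon>))
        \<le> real ?n * ?A ^ ?n * (?A * (?h ^ m * ?M))"
    proof (rule mollifier_approx(2)[OF _ assms(1)])
      show "u \<epsilon> \<in> C_infinity \<Omega>" using u \<epsilon> E_M_inf_subset E_M_C_infinity by blast
      show "y \<in> \<Omega>" if "\<forall>i. \<bar>y $ i - x \<epsilon> $ i\<bar> \<le> ?h" for y using mem[OF that] L(2) by blast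
      show "cmod ((partial_D k ^^ m) (u \<epsilon>) y) \<le> ?M" if "\<forall>i. \<bar>y $ i - x \<epsilon> $ i\<bar> \<le> ?h" for k y
      proof -
        have "cmod ((partial_D k ^^ m) (u \<epsilon>) y) \<le> C k * (1 / \<epsilon> ^ N)" using M mem[OF that] by blast
        also have "\<dots> \<le> ?M" using CB[of k] \<epsilon> by (intro mult_right_mono) auto
        finally show ?thesis .
      qed
    qed (use h mq in \<open>auto simp: m_def\<close>)
    also have "\<dots> \<le> real ?n * (1 / \<epsilon>) ^ ?n * (1 / \<epsilon> * (\<epsilon> ^ m * ?M))"
      using A h \<epsilon> B0 richardson_norm_ge_1[of "q \<epsilon>"]
      by (intro mult_mono mult_left_mono power_mono mult_right_mono) auto
    also have "\<dots> = (real ?n * B) * \<epsilon> ^ r"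
      using \<epsilon> by (simp add: m_def power_add power_divide)
    finally show ?case using xK by (simp add: point_net_def)
  qed
  then show "\<exists>C. \<forall>\<^sub>F \<epsilon> in at_right 0. \<forall>_\<in>{()}.
      cmod ((LINT y|lborel. point_net q \<delta> K x \<epsilon> y * u \<epsilon> y) - u \<epsilon> (x \<epsilon>)) \<le> C * \<epsilon> ^ r"
    by auto
qed

subsection \<open>Integrals and point values\<close>

text \<open>An admissible \<open>K\<close> surrounds the support of the class \<open>W\<close>, but
  it may miss part of the set \<open>L\<close> that carries \<open>v u\<close>. On that part
  \<open>w\<close> is negligible, by the definition of the support and compactness of
  \<open>L - interior K\<close>. So the two integrands differ by a negligible net on
  \<open>K \<union> L\<close> and agree elsewhere.\<close>

lemma G_integral_representative:
  fixes \<Omega> :: "(real^'n::finite) set"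
  assumes "open \<Omega>" "v \<in> E_M \<Omega>" "u \<in> E_M \<Omega>" and L: "compact L" "L \<subseteq> \<Omega>"
    and zero: "\<And>\<epsilon> y. \<epsilon> \<in> {0<..1} \<Longrightarrow> y \<notin> L \<Longrightarrow> v \<epsilon> y = 0"
    and W: "W = G_class \<Omega> v \<otimes>\<^bsub>G \<Omega>\<^esub> G_class \<Omega> u" "w \<in> W"
    and K: "compact K" "K \<subseteq> \<Omega>" "G_supp \<Omega> W \<subseteq> interior K"
  shows "(\<lambda>\<epsilon>. (LINT y:K|lborel. w \<epsilon> y) - (LINT y|lborel. v \<epsilon> y * u \<epsilon> y)) \<in> C_N"
proof -
  define D where "D \<epsilon> y = indicator K y *\<^sub>R w \<epsilon> y - v \<epsilon> y * u \<epsilon> y" for \<epsilon> y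
  note rep = G_mult_representative[OF assms(1-3) W(2)[unfolded W(1)]]
  have "negligible_on (L - interior K) w"
  proof (rule negligible_on_compact_local)
    show "compact (L - interior K)" using L by (intro compact_diff) auto
    fix y assume "y \<in> L - interior K"
    then have "y \<in> \<Omega>" "y \<notin> G_supp \<Omega> W" using L K by auto
    then obtain \<Omega>' where \<Omega>': "open \<Omega>'" "G_restrict \<Omega>' W = \<zero>\<^bsub>G \<Omega>'\<^esub>" "y \<in> \<Omega>'"
      unfolding G_supp_def by blast
    \<comment> \<open>The closed ball serves the estimates, which concern compact sets; the open one
      serves the covering.\<close>
    then obtain e where e: "e > 0" "cball y e \<subseteq> \<Omega>'" using open_contains_cball by blast
    have "negligible_on (cball y e) w"
      using G_restrict_zero_imp[OF \<Omega>'(1,2) W(2)] e by (intro E_N_negligible_on) auto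
    then have "negligible_on (ball y e) w" by (rule negligible_on_subset) auto
    then show "\<exists>T. open T \<and> y \<in> T \<and> negligible_on T w" using e by (intro exI[of _ "ball y e"]) auto
  qed
  then have negw: "negligible_on (L - K) w"
    by (rule negligible_on_subset) (use interior_subset in auto)
  have negd: "negligible_on (K \<union> L) (\<lambda>\<epsilon> y. w \<epsilon> y - v \<epsilon> y * u \<epsilon> y)"
    using L K by (intro rep(2)) auto
  have "negligible_on K D"
    by (rule negligible_on_lincomb[where a = 1 and b = 0, OF negligible_on_subset[OF negd] negligible_on_subset[OF negd]])
      (auto simp: D_def)
  \<comment> \<open>Here the indicator removes \<open>w\<close>, so that
    \<open>D = - v u = (w - v u) - w\<close>.\<close>
  moreover have "negligible_on (L - K) D"
    by (rule negligible_on_lincomb[where a = 1 and b = "- 1", OF negligible_on_subset[OF negd] negw])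
      (auto simp: D_def)
  ultimately have "negligible_on (K \<union> (L - K)) D" by (rule negligible_on_Un)
  then have negD: "negligible_on (K \<union> L) D" by simp
  have "integrable lborel (\<lambda>y. indicator K y *\<^sub>R w \<epsilon> y)" if "\<epsilon> \<in> {0<..1}" for \<epsilon>
    using rep(1)[OF that] K by (intro borel_integrable_compact) (auto intro: continuous_on_subset)
  moreover have "integrable lborel (\<lambda>y. v \<epsilon> y * u \<epsilon> y)" if "\<epsilon> \<in> {0<..1}" for \<epsilon>
  proof -
    have "integrable lborel (\<lambda>y. indicator L y *\<^sub>R (v \<epsilon> y * u \<epsilon> y))"
      using L that assms(2,3)
      by (intro borel_integrable_compact continuous_on_mult)
        (auto intro!: continuous_on_subset[OF C_infinity_continuous] E_M_C_infinity)
    also have "(\<lambda>y. indicator L y *\<^sub>R (v \<epsilon> y * u \<epsilon> y)) = (\<lambda>y. v \<epsilon> y * u \<epsilon> y)"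
      using zero[OF that] by (auto simp: indicator_def)
    finally show ?thesis .
  qed
  ultimately have int: "integrable lborel (D \<epsilon>)"
    "(LINT y:K|lborel. w \<epsilon> y) - (LINT y|lborel. v \<epsilon> y * u \<epsilon> y) = (LINT y|lborel. D \<epsilon> y)"
    if "\<epsilon> \<in> {0<..1}" for \<epsilon>
    using that by (auto simp: D_def[abs_def] set_lebesgue_integral_def)
  have KL: "compact (K \<union> L)" using K L by (intro compact_Un)
  show ?thesis
    unfolding C_N_iff negligible_on_def
  proof
    fix r :: nat
    obtain C where "\<forall>\<^sub>F \<epsilon> in at_right 0. \<forall>y\<in>K \<union> L. cmod (D \<epsilon> y) \<le> C * \<epsilon> ^ r"
      using negD unfolding negligible_on_def by blast
    then have "\<forall>\<^sub>F \<epsilon> in at_right 0. cmod ((LINT y:K|lborel. w \<epsilon> y) - (LINT y|lborel. v \<epsilon> y * u \<epsilon> y))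
        \<le> (C * measure lborel (K \<union> L)) * \<epsilon> ^ r"
      using eventually_index
    proof eventually_elim
      case (elim \<epsilon>)
      have "cmod (LINT y|lborel. D \<epsilon> y) \<le> (LINT y|lborel. indicator (K \<union> L) y * (C * \<epsilon> ^ r))"
      proof (rule Bochner_Integration.integral_norm_bound_integral)
        show "integrable lborel (D \<epsilon>)" using elim by (intro int)
        show "integrable lborel (\<lambda>y. indicator (K \<union> L) y * (C * \<epsilon> ^ r))"
          using borel_integrable_compact[OF KL continuous_on_const[of _ "C * \<epsilon> ^ r"]] by simp
        show "cmod (D \<epsilon> y) \<le> indicator (K \<union> L) y * (C * \<epsilon> ^ r)" for y
          using elim zero[of \<epsilon> y] by (cases "y \<in> K \<union> L") (auto simp: D_def)
      qed
      also have "\<dots> = (C * measure lborel (K \<union> L)) * \<epsilon> ^ r"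
        using KL by (simp add: compact_imp_closed)
      finally show ?case using int(2) elim by simp
    qed
    then show "\<exists>C. \<forall>\<^sub>F \<epsilon> in at_right 0. \<forall>_\<in>{()}.
        cmod ((LINT y:K|lborel. w \<epsilon> y) - (LINT y|lborel. v \<epsilon> y * u \<epsilon> y)) \<le> C * \<epsilon> ^ r"
      by auto
  qed
qed

section \<open>Point values and generalized points\<close>

lemma partial_D_Lipschitz:
  fixes f :: "real^'n::finite \<Rightarrow> complex"
  assumes "convex S" "\<And>y. y \<in> S \<Longrightarrow> f differentiable at y"
    and M: "\<And>k y. y \<in> S \<Longrightarrow> cmod (partial_D k f y) \<le> M"
    and "x \<in> S" "y \<in> S"
  shows "cmod (f x - f y) \<le> real CARD('n) * M * norm (x - y)"
proof (rule differentiable_bound[OF assms(1) _ _ assms(4,5)])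
  fix p assume p: "p \<in> S"
  note d = assms(2)[OF p]
  show "(f has_derivative frechet_derivative f (at p)) (at p within S)"
    using d by (simp add: frechet_derivative_works has_derivative_at_withinI)
  show "onorm (frechet_derivative f (at p)) \<le> real CARD('n) * M"
  proof (rule onorm_le)
    fix v :: "real^'n"
    have lin: "linear (frechet_derivative f (at p))" by (rule linear_frechet_derivative[OF d])
    \<comment> \<open>Each component of \<open>v\<close> is at most \<open>norm v\<close>, so the
      sum over the coordinates gives the factor \<open>CARD('n)\<close>.\<close>
    have "v = (\<Sum>k\<in>UNIV. v $ k *\<^sub>R axis k 1)"
      by (simp add: vec_eq_iff axis_def if_distrib cong: if_cong)
    then have "frechet_derivative f (at p) v = (\<Sum>k\<in>UNIV. v $ k *\<^sub>R partial_D k f p)"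
      using linear_sum[OF lin, of "\<lambda>k. v $ k *\<^sub>R axis k 1" UNIV]
      by (simp add: linear_scale[OF lin] partial_D_frechet[OF d])
    also have "cmod \<dots> \<le> (\<Sum>k\<in>(UNIV :: 'n set). norm v * M)"
    proof (rule sum_norm_le)
      show "cmod (v $ k *\<^sub>R partial_D k f p) \<le> norm v * M" for k
        unfolding norm_scaleR real_norm_def
        by (rule mult_mono[OF component_le_norm_cart M[OF p]]) auto
    qed
    finally show "cmod (frechet_derivative f (at p) v) \<le> real CARD('n) * M * norm v"
      by (simp add: mult_ac)
  qed
qed

text \<open>Changing the function adds a negligible net evaluated in \<open>L\<close>. Changing the
  point costs a moderate Lipschitz constant times a negligible distance; this takes place in a ball
  around \<open>x \<epsilon>\<close>, which is convex and contained in \<open>L\<close>.\<close>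

lemma point_value_representative:
  fixes \<Omega> :: "(real^'n::finite) set"
  assumes "open \<Omega>" "u \<in> E_M \<Omega>" and L: "compact L" "L \<subseteq> \<Omega>"
    and ball: "0 < d" "\<And>p. p \<in> K \<Longrightarrow> cball p d \<subseteq> L"
    and x: "\<forall>\<^sub>F \<epsilon> in at_right 0. x \<epsilon> \<in> K"
    and xy: "\<And>r::nat. \<exists>C. \<forall>\<^sub>F \<epsilon> in at_right 0. norm (x \<epsilon> - y \<epsilon>) \<le> C * \<epsilon> ^ r"
    and w: "w \<in> G_class \<Omega> u"
  shows "(\<lambda>\<epsilon>. w \<epsilon> (y \<epsilon>) - u \<epsilon> (x \<epsilon>)) \<in> C_N"
proof -
  let ?n = "real CARD('n)"
  obtain n where n: "n \<in> E_N \<Omega>" and w: "w = (\<lambda>\<epsilon> x. n \<epsilon> x + u \<epsilon> x)"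
    using w unfolding mem_G_class by blast
  obtain C1 where C1: "\<forall>\<^sub>F \<epsilon> in at_right 0. norm (x \<epsilon> - y \<epsilon>) \<le> C1 * \<epsilon> ^ 1"
    using xy by blast
  have yd: "\<forall>\<^sub>F \<epsilon> in at_right 0. y \<epsilon> \<in> cball (x \<epsilon>) d"
    using C1 eventually_le_inverse[of "C1 / d"] eventually_index
  proof eventually_elim
    case (elim \<epsilon>)
    then have "C1 * \<epsilon> \<le> d" using ball(1) by (simp add: field_simps)
    then show ?case using elim by (simp add: dist_norm)
  qed
  have "\<forall>\<^sub>F \<epsilon> in at_right 0. \<forall>_\<in>{()}. y \<epsilon> \<in> L"
    using x yd by eventually_elim (use ball(2) in blast)
  from negligible_on_comp[OF E_N_negligible_on[OF n L] this]
  have 1: "(\<lambda>\<epsilon>. n \<epsilon> (y \<epsilon>)) \<in> C_N" by (simp add: C_N_iff)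
  have "(\<lambda>\<epsilon>. u \<epsilon> (y \<epsilon>) - u \<epsilon> (x \<epsilon>)) \<in> C_N"
    unfolding C_N_iff negligible_on_def
  proof
    fix r :: nat
    have "moderate_on L (\<lambda>\<epsilon>. partial_D k (u \<epsilon>))" for k
    proof -
      have "moderate_on L (\<lambda>\<epsilon>. multi_D (\<lambda>i. if i = k then 1 else 0) (u \<epsilon>))"
        using assms(2) L unfolding E_M_iff by auto
      then show ?thesis by (simp only: multi_D_single One_nat_def funpow.simps o_id)
    qed
    then have "\<exists>(N::nat) C. \<forall>\<^sub>F \<epsilon> in at_right 0. \<forall>y\<in>L. cmod (partial_D k (u \<epsilon>) y) \<le> C * (1 / \<epsilon> ^ N)" for k
      unfolding moderate_on_def .
    from choice[OF allI[OF this]] obtain N where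
      "\<forall>k. \<exists>C. \<forall>\<^sub>F \<epsilon> in at_right 0. \<forall>y\<in>L. cmod (partial_D k (u \<epsilon>) y) \<le> C * (1 / \<epsilon> ^ (N k :: nat))" ..
    from choice[OF this] obtain C where
      NC: "\<forall>k. \<forall>\<^sub>F \<epsilon> in at_right 0. \<forall>y\<in>L. cmod (partial_D k (u \<epsilon>) y) \<le> C k * (1 / \<epsilon> ^ N k)" ..
    define N' where "N' = (\<Sum>k\<in>UNIV. N k)"
    define B where "B = (\<Sum>k\<in>UNIV. \<bar>C k\<bar>)"
    \<comment> \<open>The sum \<open>N'\<close> dominates the exponents of all first derivatives,
      and the order \<open>r + N'\<close> compensates for it.\<close>
    obtain C2 where C2: "\<forall>\<^sub>F \<epsilon> in at_right 0. norm (x \<epsilon> - y \<epsilon>) \<le> C2 * \<epsilon> ^ (r + N')"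
      using xy by blast
    have "\<forall>\<^sub>F \<epsilon> in at_right 0. \<forall>k. \<forall>y\<in>L. cmod (partial_D k (u \<epsilon>) y) \<le> C k * (1 / \<epsilon> ^ N k)"
      by (rule eventually_all_finite[OF NC[rule_format]])
    then have "\<forall>\<^sub>F \<epsilon> in at_right 0. cmod (u \<epsilon> (y \<epsilon>) - u \<epsilon> (x \<epsilon>)) \<le> (?n * B * C2) * \<epsilon> ^ r"
      using C2 x yd eventually_index
    proof eventually_elim
      case (elim \<epsilon>)
      have sub: "cball (x \<epsilon>) d \<subseteq> L" using ball(2) elim by blast
      have "cmod (u \<epsilon> (y \<epsilon>) - u \<epsilon> (x \<epsilon>)) \<le> ?n * (B * (1 / \<epsilon> ^ N')) * norm (y \<epsilon> - x \<epsilon>)"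
      proof (rule partial_D_Lipschitz[of "cball (x \<epsilon>) d"])
        show "u \<epsilon> differentiable at p" if "p \<in> cball (x \<epsilon>) d" for p
        proof -
          have "p \<in> \<Omega>" using that sub L(2) by blast
          then show ?thesis
            using C_infinity_differentiable[OF E_M_C_infinity[OF assms(2) elim(5)]] assms(1)
            by (simp add: differentiable_on_eq_differentiable_at)
        qed
        show "cmod (partial_D k (u \<epsilon>) p) \<le> B * (1 / \<epsilon> ^ N')" if "p \<in> cball (x \<epsilon>) d" for k p
        proof -
          have "cmod (partial_D k (u \<epsilon>) p) \<le> C k * (1 / \<epsilon> ^ N k)" using elim(1) that sub by blast
          also have "\<dots> \<le> B * (1 / \<epsilon> ^ N')"
          proof (rule mult_mono)
            show "C k \<le> B" using member_le_sum[of k UNIV "\<lambda>k. \<bar>C k\<bar>"] by (simp add: B_def)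
            have "N k \<le> N'" using member_le_sum[of k UNIV N] by (simp add: N'_def)
            then have "\<epsilon> ^ N' \<le> \<epsilon> ^ N k" using elim(5) by (intro power_decreasing) auto
            then show "1 / \<epsilon> ^ N k \<le> 1 / \<epsilon> ^ N'" using elim(5) by (intro divide_left_mono) auto
          qed (use elim(5) in \<open>auto simp: B_def sum_nonneg\<close>)
          finally show ?thesis .
        qed
      qed (use elim ball(1) in auto)
      also have "\<dots> \<le> ?n * (B * (1 / \<epsilon> ^ N')) * (C2 * \<epsilon> ^ (r + N'))"
        using elim by (intro mult_left_mono) (auto simp: norm_minus_commute B_def sum_nonneg)
      also have "\<dots> = (?n * B * C2) * \<epsilon> ^ r" using elim by (simp add: power_add)
      finally show ?case .
    qed
    then show "\<exists>C. \<forall>\<^sub>F \<epsilon> in at_right 0. \<forall>_\<in>{()}. cmod (u \<epsilon> (y \<epsilon>) - u \<epsilon> (x \<epsilon>)) \<le> C * \<epsilon> ^ r"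
      by auto
  qed
  from C_N_lincomb[OF 1 this, where a = 1 and b = 1] show ?thesis by (simp add: w)
qed

lemma Omega_rel_bound:
  "(x, y) \<in> Omega_rel \<Omega> \<Longrightarrow> \<exists>C. \<forall>\<^sub>F \<epsilon> in at_right 0. norm (x \<epsilon> - y \<epsilon>) \<le> C * \<epsilon> ^ (r::nat)"
  by (auto simp: Omega_rel_def bigo_at_right_iff)

text \<open>Both nets are compared with the net \<open>z\<close> that generates the class.\<close>

lemma Omega_tilde_bound:
  assumes "X \<in> Omega_tilde \<Omega>" "x \<in> X" "y \<in> X"
  shows "\<exists>C. \<forall>\<^sub>F \<epsilon> in at_right 0. norm (x \<epsilon> - y \<epsilon>) \<le> C * \<epsilon> ^ (r::nat)"
proof -
  obtain z where "(z, x) \<in> Omega_rel \<Omega>" "(z, y) \<in> Omega_rel \<Omega>"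
    using assms by (auto simp: Omega_tilde_def quotient_def)
  from this[THEN Omega_rel_bound, of r] obtain C D
    where "\<forall>\<^sub>F \<epsilon> in at_right 0. norm (z \<epsilon> - x \<epsilon>) \<le> C * \<epsilon> ^ r"
      "\<forall>\<^sub>F \<epsilon> in at_right 0. norm (z \<epsilon> - y \<epsilon>) \<le> D * \<epsilon> ^ r"
    by auto
  then have "\<forall>\<^sub>F \<epsilon> in at_right 0. norm (x \<epsilon> - y \<epsilon>) \<le> (C + D) * \<epsilon> ^ r"
  proof eventually_elim
    case (elim \<epsilon>)
    then show ?case
      using norm_triangle_ineq4[of "z \<epsilon> - y \<epsilon>" "z \<epsilon> - x \<epsilon>"] by (simp add: distrib_right)
  qed
  then show ?thesis ..
qed

lemma compact_neighbourhood:
  fixes \<Omega> :: "'a::euclidean_space set"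
  assumes "open \<Omega>" "compact K" "K \<subseteq> \<Omega>"
  obtains L d where "compact L" "L \<subseteq> \<Omega>" "0 < d" "\<And>p. p \<in> K \<Longrightarrow> cball p d \<subseteq> L"
proof -
  obtain d where d: "0 < d" "(\<Union>p\<in>K. cball p d) \<subseteq> \<Omega>"
    using compact_subset_open_imp_cball_epsilon_subset[OF assms(2,1,3)] .
  \<comment> \<open>As a sum of two compact sets, this neighbourhood is compact.\<close>
  define L where "L = {p + z |p z. p \<in> K \<and> z \<in> cball 0 d}"
  show ?thesis
  proof (rule that)
    show "compact L" unfolding L_def by (intro compact_sums assms) auto
    show "L \<subseteq> \<Omega>"
    proof
      fix y assume "y \<in> L"
      then obtain p where "p \<in> K" "y \<in> cball p d" by (auto simp: L_def dist_norm)
      then show "y \<in> \<Omega>" using d(2) by blast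
    qed
    show "cball p d \<subseteq> L" if "p \<in> K" for p
    proof
      fix y assume "y \<in> cball p d"
      then have "y = p + (y - p)" "y - p \<in> cball 0 d" by (auto simp: dist_norm norm_minus_commute)
      then show "y \<in> L" using that unfolding L_def by blast
    qed
  qed (rule d(1))
qed

theorem theorem2p1:
  fixes \<Omega> :: "(real^'n::finite) set"
  assumes "open \<Omega>"
  shows "\<forall>X\<in>Omega_tilde_c \<Omega>. \<exists>V\<in>G_c \<Omega>. \<forall>U\<in>G_inf \<Omega>.
           point_value U X = G_integral \<Omega> (V \<otimes>\<^bsub>G \<Omega>\<^esub> U)"
proof
  fix X assume X: "X \<in> Omega_tilde_c \<Omega>"
  then obtain x K where xX: "x \<in> X" and K: "compact K" "K \<subseteq> \<Omega>"
    and x: "\<forall>\<^sub>F \<epsilon> in at_right 0. x \<epsilon> \<in> K"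
    by (auto simp: Omega_tilde_c_def)
  obtain L d where L: "compact L" "L \<subseteq> \<Omega>" and d: "0 < d" and ball: "\<And>p. p \<in> K \<Longrightarrow> cball p d \<subseteq> L"
    using compact_neighbourhood[OF assms K] by blast
  \<comment> \<open>By the l1 bound for the norm, a cube of half-side \<open>d / CARD('n)\<close>
    lies in the ball of radius \<open>d\<close>.\<close>
  define \<delta> where "\<delta> = min 1 (d / real CARD('n))"
  have \<delta>: "0 < \<delta>" "\<delta> \<le> 1" using d by (auto simp: \<delta>_def)
  have box: "y \<in> L" if "p \<in> K" "\<forall>i. \<bar>y $ i - p $ i\<bar> \<le> \<delta>" for p y
  proof -
    have "norm (y - p) \<le> (\<Sum>i\<in>(UNIV :: 'n set). \<delta>)"
      by (rule order.trans[OF norm_le_l1_cart sum_mono]) (use that in simp)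
    also have "\<dots> \<le> d" using d by (simp add: \<delta>_def min_def field_simps)
    finally have "y \<in> cball p d" by (simp add: dist_norm norm_minus_commute)
    then show ?thesis using ball[OF that(1)] by blast
  qed
  \<comment> \<open>The bound on the weights serves both the error and moderateness, the bound on
    \<open>2 ^ q\<close> serves moderateness. Nothing here refers to \<open>U\<close>.\<close>
  obtain q :: "real \<Rightarrow> nat" where q: "\<forall>\<^sub>F \<epsilon> in at_right 0. max (richardson_norm (q \<epsilon>)) (2 ^ q \<epsilon>) \<le> 1 / \<epsilon>"
    "\<And>m. \<forall>\<^sub>F \<epsilon> in at_right 0. m \<le> q \<epsilon>"
    using slow_index_exists[of "\<lambda>k. max (richardson_norm k) (2 ^ k)"] by blast
  have A: "\<forall>\<^sub>F \<epsilon> in at_right 0. richardson_norm (q \<epsilon>) \<le> 1 / \<epsilon>"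
    and q2: "\<forall>\<^sub>F \<epsilon> in at_right 0. 2 ^ q \<epsilon> \<le> 1 / \<epsilon>"
    using q(1) by (auto elim: eventually_mono)
  define v where "v = point_net q \<delta> K x"
  have v: "v \<in> E_M \<Omega>" unfolding v_def by (rule point_net_E_M[OF assms \<delta> A q2])
  have v0: "v \<epsilon> y = 0" if "\<epsilon> \<in> {0<..1}" "y \<notin> L" for \<epsilon> y
    unfolding v_def using box \<delta>(1) that by (rule point_net_eq_0)
  have "open (\<Omega> - L)" using assms L by (intro open_Diff compact_imp_closed)
  then have vN: "v \<in> E_N (\<Omega> - L)"
    using C_infinity_subset[OF E_M_C_infinity[OF v], of _ "\<Omega> - L"] v0 by (intro E_N_zero_on) auto
  show "\<exists>V\<in>G_c \<Omega>. \<forall>U\<in>G_inf \<Omega>. point_value U X = G_integral \<Omega> (V \<otimes>\<^bsub>G \<Omega>\<^esub> U)"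
  proof (intro bexI ballI)
    show "G_class \<Omega> v \<in> G_c \<Omega>"
      by (rule G_class_in_G_c[OF assms v L vN])
    fix U assume "U \<in> G_inf \<Omega>"
    then obtain u where u: "u \<in> E_M_inf \<Omega>" and U: "U = G_class \<Omega> u" by (auto simp: G_inf_def)
    have uM: "u \<in> E_M \<Omega>" using u E_M_inf_subset by blast
    define W where "W = G_class \<Omega> v \<otimes>\<^bsub>G \<Omega>\<^esub> G_class \<Omega> u"
    let ?z = "C_class (\<lambda>\<epsilon>. u \<epsilon> (x \<epsilon>))"
    have pv: "C_class (\<lambda>\<epsilon>. w \<epsilon> (y \<epsilon>)) = ?z" if "w \<in> U" "y \<in> X" for w y
    proof (rule C_class_eq, rule point_value_representative[OF assms uM L d ball x])
      show "\<exists>C. \<forall>\<^sub>F \<epsilon> in at_right 0. norm (x \<epsilon> - y \<epsilon>) \<le> C * \<epsilon> ^ r" for r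
        using X xX that(2) by (intro Omega_tilde_bound) (auto simp: Omega_tilde_c_def)
    qed (use that U in auto)
    have "u \<in> U" unfolding U by (rule mem_G_class_self[OF assms])
    then have pv: "point_value U X = ?z" using pv xX unfolding point_value_def by blast
    have int: "C_class (\<lambda>\<epsilon>. LINT y:K'|lborel. w \<epsilon> y) = ?z"
      if "w \<in> W" "compact K'" "K' \<subseteq> \<Omega>" "G_supp \<Omega> W \<subseteq> interior K'" for w K'
    proof (rule C_class_eq)
      show "(\<lambda>\<epsilon>. (LINT y:K'|lborel. w \<epsilon> y) - u \<epsilon> (x \<epsilon>)) \<in> C_N"
        \<comment> \<open>The two errors telescope through the integral of \<open>v u\<close> over
          the whole space.\<close>
        by (rule C_N_lincomb[where a = 1 and b = 1,
              OF G_integral_representative[OF assms v uM L v0 W_def that]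
                point_net_approx[OF assms \<delta> L box x A q(2) u]])
          (simp_all add: v_def)
    qed
    \<comment> \<open>The integral is a union of classes that all equal \<open>?z\<close>; to be
      \<open>?z\<close> itself it must not be a union over an empty family, so a representative and
      an admissible compact set have to be exhibited.\<close>
    have W: "W \<noteq> {}" unfolding W_def by (rule G_mult_nonempty[OF assms])
    have K': "\<exists>K'. compact K' \<and> K' \<subseteq> \<Omega> \<and> G_supp \<Omega> W \<subseteq> interior K'"
    proof -
      have "G_supp \<Omega> W \<subseteq> L"
        using G_mult_subset_E_N[OF assms \<open>open (\<Omega> - L)\<close> _ vN uM] W assms L
        unfolding W_def by (intro G_supp_subset) auto
      moreover obtain L' e where L': "compact L'" "L' \<subseteq> \<Omega>" "0 < e" "\<And>p. p \<in> L \<Longrightarrow> cball p e \<subseteq> L'"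
        using compact_neighbourhood[OF assms L] by blast
      moreover have "L \<subseteq> interior L'"
      proof
        fix p assume "p \<in> L"
        then have "ball p e \<subseteq> L'" using L'(4) ball_subset_cball by blast
        then show "p \<in> interior L'" using L'(3) unfolding mem_interior by blast
      qed
      ultimately show ?thesis by (intro exI[of _ L']) auto
    qed
    have "G_integral \<Omega> W = ?z"
    proof -
      let ?\<K> = "{K'. compact K' \<and> K' \<subseteq> \<Omega> \<and> G_supp \<Omega> W \<subseteq> interior K'}"
      have "G_integral \<Omega> W = (\<Union>w\<in>W. \<Union>K'\<in>?\<K>. ?z)"
        unfolding G_integral_def by (intro SUP_cong refl int) auto
      also have "\<dots> = ?z" using W K' by auto
      finally show ?thesis .
    qed
    then show "point_value U X = G_integral \<Omega> (G_class \<Omega> v \<otimes>\<^bsub>G \<Omega>\<^esub> U)"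
      using pv unfolding W_def U by simp
  qed
qed

end
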